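(* Let $(X,d)$ be a proper geodesic Gromov hyperbolic metric space and let $f\colon X\to X$ be a hyperbolic isometry with Denjoy--Wolff point $\zeta\in\partial_G X$. If $(X,d)$ has approaching geodesics at $\zeta$, then $f$ is axial and the axis of $f$ is unique (up to reparametrization of the geodesic line).
   Context: A geodesic in $(X,d)$ is a map $\gamma\colon I\to X$ from an interval $I\subset\mathbb{R}$ with $d(\gamma(s),\gamma(t))=|t-s|$ for all $s,t\in I$; it is a geodesic ray if $I=[0,+\infty)$ and a geodesic line if $I=\mathbb{R}$. The space is geodesic if any two points are joined by a geodesic, and proper if closed balls are compact. A proper geodesic metric space is Gromov hyperbolic if there is $\delta\ge 0$ such that in every geodesic triangle each side is contained in the $\delta$-neighborhood of the union of the other two sides. Two geodesic rays $\gamma,\sigma$ are asymptotic if $\sup_{t\ge 0}d(\gamma(t),\sigma(t))<+\infty$, and strongly asymptotic if there exists $T\in\mathbb{R}$ such that $\lim_{t\to+\infty}d(\gamma(t),\sigma(t+T))=0$. The Gromov boundary $\partial_G X$ is the set of geodesic rays modulo the relation of being asymptotic; the endpoint of a ray is its class. The Gromov compactification $\overline{X}^G=X\sqcup\partial_G X$ carries its usual compact metrizable topology. For $\xi\in\partial_G X$, $X$ has approaching geodesics at $\xi$ if any two geodesic rays with endpoint $\xi$ are strongly asymptotic. An isometry of $X$ is a distance-preserving bijection $f\colon X\to X$. The divergence rate is $c(f):=\lim_{n\to+\infty}\frac{d(x,f^n(x))}{n}$, which exists and does not depend on $x\in X$. The isometry $f$ is elliptic if it has a bounded orbit, and hyperbolic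 if it is non-elliptic and $c(f)>0$. For a non-elliptic isometry $f$ the Denjoy--Wolff point is the unique point $\zeta\in\partial_G X$ such that $f^n(x)\to\zeta$ in $\overline{X}^G$ for all $x\in X$ (it exists by a known theorem of Karlsson). An axis of an isometry $f$ without fixed points is a geodesic line that is setwise invariant under $f$. Such an $f$ is axial if it has an axis. *)

theory Defs
  imports "HOL-Analysis.Analysis"
begin

section \<open>Geodesics and hyperbolicity\<close>

text \<open>A geodesic on an interval \<open>I\<close> is represented by a total function of which only the
  values on \<open>I\<close> matter.\<close>

definition geodesic_on :: "real set \<Rightarrow> (real \<Rightarrow> 'a::metric_space) \<Rightarrow> bool" where
  "geodesic_on I \<gamma> \<longleftrightarrow> (\<forall>s\<in>I. \<forall>t\<in>I. dist (\<gamma> s) (\<gamma> t) = \<bar>t - s\<bar>)"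

definition geodesic_ray :: "(real \<Rightarrow> 'a::metric_space) \<Rightarrow> bool" where
  "geodesic_ray \<gamma> \<longleftrightarrow> geodesic_on {0..} \<gamma>"

definition geodesic_line :: "(real \<Rightarrow> 'a::metric_space) \<Rightarrow> bool" where
  "geodesic_line \<gamma> \<longleftrightarrow> geodesic_on UNIV \<gamma>"

definition geodesic_segment :: "'a::metric_space \<Rightarrow> 'a \<Rightarrow> 'a set \<Rightarrow> bool" where
  "geodesic_segment x y S \<longleftrightarrow>
     (\<exists>\<gamma> a b. a \<le> b \<and> geodesic_on {a..b} \<gamma> \<and> \<gamma> a = x \<and> \<gamma> b = y \<and> S = \<gamma> ` {a..b})"

definition geodesic_space :: "'a::metric_space itself \<Rightarrow> bool" where
  "geodesic_space _ \<longleftrightarrow> (\<forall>x y::'a. \<exists>S. geodesic_segment x y S)"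

definition proper_space :: "'a::metric_space itself \<Rightarrow> bool" where
  "proper_space _ \<longleftrightarrow> (\<forall>(x::'a) r. compact (cball x r))"

definition neighborhood :: "real \<Rightarrow> 'a::metric_space set \<Rightarrow> 'a set" where
  "neighborhood \<delta> S = {x. \<exists>y\<in>S. dist x y \<le> \<delta>}"

definition gromov_hyperbolic :: "'a::metric_space itself \<Rightarrow> bool" where
  "gromov_hyperbolic _ \<longleftrightarrow>
     (\<exists>\<delta>\<ge>0. \<forall>(x::'a) y z A B C.
        geodesic_segment x y A \<and> geodesic_segment y z B \<and> geodesic_segment z x C \<longrightarrow>
        A \<subseteq> neighborhood \<delta> (B \<union> C) \<and>
        B \<subseteq> neighborhood \<delta> (C \<union> A) \<and>
        C \<subseteq> neighborhood \<delta> (A \<union> B))"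


section \<open>The Gromov boundary and compactification\<close>

definition asymptotic :: "(real \<Rightarrow> 'a::metric_space) \<Rightarrow> (real \<Rightarrow> 'a) \<Rightarrow> bool" where
  "asymptotic \<gamma> \<sigma> \<longleftrightarrow> bdd_above ((\<lambda>t. dist (\<gamma> t) (\<sigma> t)) ` {0..})"

definition strongly_asymptotic :: "(real \<Rightarrow> 'a::metric_space) \<Rightarrow> (real \<Rightarrow> 'a) \<Rightarrow> bool" where
  "strongly_asymptotic \<gamma> \<sigma> \<longleftrightarrow> (\<exists>T. ((\<lambda>t. dist (\<gamma> t) (\<sigma> (t + T))) \<longlongrightarrow> 0) at_top)"

definition asymptotic_rel :: "((real \<Rightarrow> 'a::metric_space) \<times> (real \<Rightarrow> 'a)) set" where
  "asymptotic_rel = {(\<gamma>, \<sigma>). geodesic_ray \<gamma> \<and> geodesic_ray \<sigma> \<and> asymptotic \<gamma> \<sigma>}"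

text \<open>Two functions that agree on \<open>[0,\<infinity>)\<close> are asymptotic, so the irrelevant values on the
  negative reals disappear in the quotient.\<close>

definition gromov_boundary :: "(real \<Rightarrow> 'a::metric_space) set set" where
  "gromov_boundary = {\<gamma>. geodesic_ray \<gamma>} // asymptotic_rel"

definition endpoint :: "(real \<Rightarrow> 'a::metric_space) \<Rightarrow> (real \<Rightarrow> 'a) set" where
  "endpoint \<gamma> = asymptotic_rel `` {\<gamma>}"

lemma equiv_asymptotic_rel: "equiv {\<gamma>. geodesic_ray \<gamma>} asymptotic_rel"
proof (rule equivI)
  show "trans (asymptotic_rel :: ((real \<Rightarrow> 'a) \<times> (real \<Rightarrow> 'a)) set)"
  proof (rule transI)
    fix \<gamma> \<sigma> \<tau> :: "real \<Rightarrow> 'a"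
    assume "(\<gamma>, \<sigma>) \<in> asymptotic_rel" "(\<sigma>, \<tau>) \<in> asymptotic_rel"
    then obtain A B where r: "geodesic_ray \<gamma>" "geodesic_ray \<tau>"
      and A: "\<And>t. t \<ge> 0 \<Longrightarrow> dist (\<gamma> t) (\<sigma> t) \<le> A"
      and B: "\<And>t. t \<ge> 0 \<Longrightarrow> dist (\<sigma> t) (\<tau> t) \<le> B"
      by (auto simp: asymptotic_rel_def asymptotic_def bdd_above_def)
    have "dist (\<gamma> t) (\<tau> t) \<le> A + B" if "t \<ge> 0" for t
      using A[OF that] B[OF that] dist_triangle[of "\<gamma> t" "\<tau> t" "\<sigma> t"] by linarith
    with r show "(\<gamma>, \<tau>) \<in> asymptotic_rel"
      by (auto simp: asymptotic_rel_def asymptotic_def bdd_above_def)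
  qed
qed (auto simp: asymptotic_rel_def asymptotic_def refl_on_def sym_def dist_commute)

definition gromov_product :: "'a::metric_space \<Rightarrow> 'a \<Rightarrow> 'a \<Rightarrow> real" where
  "gromov_product p x y = (dist p x + dist p y - dist x y) / 2"

text \<open>The standard neighbourhoods of a boundary point \<open>\<xi>\<close> in the compactification \<open>X \<squnion> \<partial>\<^sub>G X\<close>,
  the disjoint union being rendered by the sum type: the points and boundary points whose
  Gromov product with \<open>\<xi>\<close>, based at \<open>p\<close>, is at least \<open>r\<close>. Following the usual convention,
  Gromov products with boundary points are lower limits along representing rays; in a hyperbolic
  space the choice of the rays changes them by a bounded amount only.\<close>

definition boundary_nhd ::
    "'a::metric_space \<Rightarrow> real \<Rightarrow> (real \<Rightarrow> 'a) set \<Rightarrow> ('a + (real \<Rightarrow> 'a) set) set" where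
  "boundary_nhd p r \<xi> =
     Inl ` {x. \<exists>\<gamma>. geodesic_ray \<gamma> \<and> endpoint \<gamma> = \<xi> \<and>
               ereal r \<le> Liminf at_top (\<lambda>t. ereal (gromov_product p x (\<gamma> t)))} \<union>
     Inr ` {\<eta> \<in> gromov_boundary. \<exists>\<gamma> \<sigma>.
               geodesic_ray \<gamma> \<and> endpoint \<gamma> = \<xi> \<and> geodesic_ray \<sigma> \<and> endpoint \<sigma> = \<eta> \<and>
               ereal r \<le> Liminf (at_top \<times>\<^sub>F at_top)
                            (\<lambda>(s, t). ereal (gromov_product p (\<gamma> s) (\<sigma> t)))}"

text \<open>The topology of the Gromov compactification: \<open>X\<close> is open and carries its metric topology,
  and the sets above are a neighbourhood basis at a boundary point. Changing the base
  point \<open>p\<close> changes Gromov products by a bounded amount, so requiring the condition for all base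
  points amounts to requiring it for one.\<close>

definition gromov_open :: "('a::metric_space + (real \<Rightarrow> 'a) set) set \<Rightarrow> bool" where
  "gromov_open U \<longleftrightarrow>
     U \<subseteq> UNIV <+> gromov_boundary \<and>
     open (Inl -` U) \<and>
     (\<forall>\<xi>. Inr \<xi> \<in> U \<longrightarrow> (\<forall>p. \<exists>r. boundary_nhd p r \<xi> \<subseteq> U))"

definition gromov_compactification :: "('a::metric_space + (real \<Rightarrow> 'a) set) topology" where
  "gromov_compactification = topology gromov_open"

lemma boundary_nhd_antimono:
  assumes "r \<le> r'"
  shows "boundary_nhd p r' \<xi> \<subseteq> boundary_nhd p r \<xi>"
proof -
  have "ereal r \<le> c" if "ereal r' \<le> c" for c
    using assms that order_trans[of "ereal r" "ereal r'" c] by simp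
  then show ?thesis
    unfolding boundary_nhd_def by blast
qed

lemma istopology_gromov_open: "istopology gromov_open"
  unfolding istopology_def
proof (intro conjI allI impI)
  fix S T :: "('a + (real \<Rightarrow> 'a) set) set"
  assume S: "gromov_open S" and T: "gromov_open T"
  show "gromov_open (S \<inter> T)"
    unfolding gromov_open_def
  proof (intro conjI allI impI)
    show "S \<inter> T \<subseteq> UNIV <+> gromov_boundary"
      using S by (auto simp: gromov_open_def)
    show "open (Inl -` (S \<inter> T))"
      using S T by (auto simp: gromov_open_def vimage_Int)
    fix \<xi> p
    assume "Inr \<xi> \<in> S \<inter> T"
    then obtain r r' where "boundary_nhd p r \<xi> \<subseteq> S" "boundary_nhd p r' \<xi> \<subseteq> T"
      using S T unfolding gromov_open_def by blast
    then have "boundary_nhd p (max r r') \<xi> \<subseteq> S \<inter> T"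
      using boundary_nhd_antimono[of r "max r r'" p \<xi>] boundary_nhd_antimono[of r' "max r r'" p \<xi>]
      by auto
    then show "\<exists>r. boundary_nhd p r \<xi> \<subseteq> S \<inter> T" ..
  qed
next
  fix K :: "('a + (real \<Rightarrow> 'a) set) set set"
  assume K: "\<forall>S\<in>K. gromov_open S"
  show "gromov_open (\<Union>K)"
    unfolding gromov_open_def
  proof (intro conjI allI impI)
    show "\<Union>K \<subseteq> UNIV <+> gromov_boundary"
      using K unfolding gromov_open_def by blast
    show "open (Inl -` \<Union>K)"
      using K by (auto simp: gromov_open_def vimage_Union)
    fix \<xi> p
    assume "Inr \<xi> \<in> \<Union>K"
    then show "\<exists>r. boundary_nhd p r \<xi> \<subseteq> \<Union>K"
      using K unfolding gromov_open_def by (meson Sup_upper UnionE order_trans)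
  qed
qed

lemma openin_gromov_compactification: "openin gromov_compactification U \<longleftrightarrow> gromov_open U"
  by (simp add: gromov_compactification_def istopology_gromov_open)

lemma topspace_gromov_compactification:
  "topspace gromov_compactification = UNIV <+> gromov_boundary"
proof -
  have "Inl -` (UNIV <+> gromov_boundary :: ('a + (real \<Rightarrow> 'a) set) set) = UNIV"
    by auto
  then have "gromov_open (UNIV <+> gromov_boundary :: ('a + (real \<Rightarrow> 'a) set) set)"
    by (auto simp: gromov_open_def boundary_nhd_def)
  then show ?thesis
    unfolding topspace_def openin_gromov_compactification by (auto simp: gromov_open_def)
qed

definition approaching_geodesics_at :: "(real \<Rightarrow> 'a::metric_space) set \<Rightarrow> bool" where
  "approaching_geodesics_at \<xi> \<longleftrightarrow>
     (\<forall>\<gamma> \<sigma>. geodesic_ray \<gamma> \<and> geodesic_ray \<sigma> \<and> endpoint \<gamma> = \<xi> \<and> endpoint \<sigma> = \<xi> \<longrightarrow>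
            strongly_asymptotic \<gamma> \<sigma>)"


section \<open>Isometries\<close>

definition isometry :: "('a::metric_space \<Rightarrow> 'a) \<Rightarrow> bool" where
  "isometry f \<longleftrightarrow> bij f \<and> (\<forall>x y. dist (f x) (f y) = dist x y)"

definition divergence_rate :: "('a::metric_space \<Rightarrow> 'a) \<Rightarrow> real" where
  "divergence_rate f = (THE c. \<forall>x. (\<lambda>n. dist x ((f ^^ n) x) / real n) \<longlonglongrightarrow> c)"

definition elliptic :: "('a::metric_space \<Rightarrow> 'a) \<Rightarrow> bool" where
  "elliptic f \<longleftrightarrow> isometry f \<and> (\<exists>x. bounded (range (\<lambda>n. (f ^^ n) x)))"

definition hyperbolic :: "('a::metric_space \<Rightarrow> 'a) \<Rightarrow> bool" where
  "hyperbolic f \<longleftrightarrow> isometry f \<and> \<not> elliptic f \<and> divergence_rate f > 0"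

text \<open>In a proper geodesic Gromov hyperbolic space the compactification is Hausdorff, so a
  boundary point with this property is unique.\<close>

definition denjoy_wolff_point :: "('a::metric_space \<Rightarrow> 'a) \<Rightarrow> (real \<Rightarrow> 'a) set \<Rightarrow> bool" where
  "denjoy_wolff_point f \<zeta> \<longleftrightarrow>
     \<zeta> \<in> gromov_boundary \<and>
     (\<forall>x. limitin gromov_compactification (\<lambda>n. Inl ((f ^^ n) x)) (Inr \<zeta>) sequentially)"

definition is_axis :: "('a::metric_space \<Rightarrow> 'a) \<Rightarrow> (real \<Rightarrow> 'a) \<Rightarrow> bool" where
  "is_axis f \<gamma> \<longleftrightarrow> geodesic_line \<gamma> \<and> f ` range \<gamma> = range \<gamma>"

definition axial :: "('a::metric_space \<Rightarrow> 'a) \<Rightarrow> bool" where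
  "axial f \<longleftrightarrow> isometry f \<and> (\<forall>x. f x \<noteq> x) \<and> (\<exists>\<gamma>. is_axis f \<gamma>)"

text \<open>Geodesic lines have unit speed, so a change of parameter is an isometry
  \<open>t \<mapsto> \<plusminus>t + b\<close> of the real line. Orientation reversal has to be allowed, since the reverse of an
  axis is again an axis.\<close>

definition reparametrization :: "(real \<Rightarrow> 'a::metric_space) \<Rightarrow> (real \<Rightarrow> 'a) \<Rightarrow> bool" where
  "reparametrization \<gamma> \<sigma> \<longleftrightarrow> (\<exists>\<phi>::real \<Rightarrow> real. isometry \<phi> \<and> \<sigma> = \<gamma> \<circ> \<phi>)"

end

theory Submission
  imports Defs
begin

text \<open>
  \<^bold>\<open>Existence.\<close> Let \<open>\<gamma>\<close> be a ray with endpoint \<open>\<zeta>\<close>. Orbits of \<open>f\<close> converge to \<open>\<zeta>\<close>, so \<open>f\<close> fixes \<open>\<zeta>\<close>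
  and \<open>f \<circ> \<gamma>\<close> is asymptotic to \<open>\<gamma>\<close> (\<open>isometry_fixes_limit\<close>). Geodesics approach each other at \<open>\<zeta>\<close>; hence
  there is a shift \<open>T\<close> with \<open>d(f(\<gamma>(t)), \<gamma>(t + T)) \<rightarrow> 0\<close>. Iterating this far out on the ray shows that
  \<open>d(x, f\<^sup>n(x)) / n\<close> tends to \<open>\<bar>T\<bar>\<close>, so that \<open>\<bar>T\<bar>\<close> is the divergence rate and \<open>T \<noteq> 0\<close>; passing
  to the inverse of \<open>f\<close> one may assume \<open>T > 0\<close> (\<open>hyperbolic_translates\<close>).

  The geodesics \<open>f\<^sup>-\<^sup>m(\<gamma>(\<cdot> + m T))\<close> are defined on longer and longer intervals \<open>[-m T, \<infinity>)\<close>, and \<open>f\<close>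
  carries the one for \<open>m\<close> to a translate by \<open>T\<close> of itself up to an error tending to \<open>0\<close>. If they stay
  bounded for infinitely many \<open>m\<close>, a pointwise cluster point is therefore a line \<open>\<sigma>\<close> with \<open>f(\<sigma>(t)) = \<sigma>(t + T)\<close>,
  an axis (\<open>invariant_line_exists\<close>). The boundedness says that \<open>f\<^sup>m(\<gamma>(0))\<close> is close to \<open>\<gamma>(m T)\<close>. Along
  the orbit the distance of these points grows at most sublinearly, and hyperbolicity forces
  the rays \<open>f\<^sup>m \<circ> \<gamma>\<close> and \<open>\<gamma>(\<cdot> + m T)\<close> to be uniformly close after a time equal to the distance of their
  origins (\<open>strongly_asymptotic_fellow_travel\<close>); so for a large step \<open>N\<close> the bound \<open>N T\<close> on this
  distance passes from \<open>m\<close> to \<open>m + N\<close> (\<open>orbit_close_to_ray\<close>).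

  \<^bold>\<open>Uniqueness.\<close> On an axis \<open>\<rho>\<close> the isometry acts as a translation, since a reflection has a fixed
  point, and the length of the translation is the divergence rate. The distance between \<open>\<rho>\<close>
  and the axis \<open>\<sigma>\<close> found above, oriented alike, is then periodic. Hence \<open>\<rho>\<close> ends in \<open>\<zeta>\<close> as well and,
  after a shift of parameter, \<open>d(\<rho>(t), \<sigma>(t))\<close> tends to \<open>0\<close>; being periodic it vanishes (\<open>translated_lines_same_range\<close>).

  Hyperbolicity enters in the form of the four-point inequality
  \<open>(x|z)\<^sub>p \<ge> min (x|y)\<^sub>p (y|z)\<^sub>p - \<delta>\<close> for Gromov products.
\<close>

section \<open>Gromov products and the four-point condition\<close>

lemma gromov_product_commute: "gromov_product p x y = gromov_product p y x"
  by (simp add: gromov_product_def dist_commute)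

lemma gromov_product_le_dist:
  "gromov_product p x y \<le> dist p x" "gromov_product p x y \<le> dist p y"
  using dist_triangle[of p y x] dist_triangle[of p x y]
  by (auto simp: gromov_product_def dist_commute)

lemma gromov_product_change_base: "gromov_product p x y \<le> gromov_product q x y + dist p q"
  using dist_triangle[of p x q] dist_triangle[of p y q]
  by (simp add: gromov_product_def field_simps)

definition four_point :: "'a::metric_space itself \<Rightarrow> real \<Rightarrow> bool" where
  "four_point _ \<delta> \<longleftrightarrow> \<delta> \<ge> 0 \<and> (\<forall>p x y z::'a.
     min (gromov_product p x y) (gromov_product p y z) - \<delta> \<le> gromov_product p x z)"

lemma four_pointD:
  fixes p :: "'a::metric_space"
  assumes "four_point TYPE('a) \<delta>"
    and "m \<le> gromov_product p x y" "m \<le> gromov_product p y z"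
  shows "m - \<delta> \<le> gromov_product p x z"
proof -
  have "min (gromov_product p x y) (gromov_product p y z) - \<delta> \<le> gromov_product p x z"
    using assms(1) by (simp only: four_point_def)
  then show ?thesis
    using assms(2,3) by linarith
qed

lemma dist_along_segment:
  assumes "geodesic_segment x y A" "z \<in> A"
  shows "dist x z + dist z y = dist x y"
  using assms by (auto simp: geodesic_segment_def geodesic_on_def)

lemma gromov_product_le_dist_segment:
  assumes "geodesic_segment x y A" "z \<in> A"
  shows "gromov_product p x y \<le> dist p z"
  using dist_along_segment[OF assms] dist_triangle[of p x z] dist_triangle[of p y z]
  by (simp add: gromov_product_def dist_commute)

lemma dist_detour_le_infdist:
  assumes "geodesic_segment p x B"
  shows "dist p z + dist z x \<le> dist p x + 2 * infdist z B"
proof -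
  have ne: "B \<noteq> {}"
    using assms by (auto simp: geodesic_segment_def)
  have "(dist p z + dist z x - dist p x) / 2 \<le> infdist z B"
    unfolding infdist_notempty[OF ne]
  proof (rule cINF_greatest[OF ne])
    fix u assume "u \<in> B"
    then show "(dist p z + dist z x - dist p x) / 2 \<le> dist z u"
      using dist_along_segment[OF assms, of u] dist_triangle[of p z u] dist_triangle[of z x u]
      by (simp add: dist_commute)
  qed
  then show ?thesis by simp
qed

lemma infdist_le_of_neighborhood:
  assumes "z \<in> neighborhood \<delta> S"
  shows "infdist z S \<le> \<delta>"
  using assms infdist_le[of _ S z] by (force simp: neighborhood_def)

text \<open>By the intermediate value theorem some point of the side \<open>A\<close> is equally far from the other
  two sides, and thinness makes it close to both.\<close>

lemma thin_triangle_center: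
  assumes A: "geodesic_segment x y A" and B: "geodesic_segment y p B"
    and C: "geodesic_segment p x C" and thin: "A \<subseteq> neighborhood \<delta> (B \<union> C)"
  obtains z where "z \<in> A" "dist p z \<le> gromov_product p x y + 2 * \<delta>"
proof -
  obtain \<gamma> a b where ab: "a \<le> b" and \<gamma>: "geodesic_on {a..b} \<gamma>" "\<gamma> a = x" "\<gamma> b = y" "A = \<gamma> ` {a..b}"
    using A by (auto simp: geodesic_segment_def)
  have cont: "continuous_on {a..b} \<gamma>"
    unfolding continuous_on_iff using \<gamma>(1)
    by (metis abs_minus_commute dist_commute dist_real_def geodesic_on_def)
  let ?h = "\<lambda>t. infdist (\<gamma> t) C - infdist (\<gamma> t) B"
  have xC: "x \<in> C" and yB: "y \<in> B"
    using B C unfolding geodesic_segment_def by force+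
  have "?h a \<le> 0" "0 \<le> ?h b"
    using xC yB \<gamma>(2,3) by (auto simp: infdist_nonneg)
  moreover have "continuous_on {a..b} ?h"
    by (intro continuous_intros cont)
  ultimately obtain t where t: "a \<le> t" "t \<le> b" "?h t = 0"
    using IVT'[of ?h a 0 b] ab by blast
  define z where "z = \<gamma> t"
  have zA: "z \<in> A"
    using t \<gamma>(4) by (auto simp: z_def)
  have eq: "infdist z C = infdist z B"
    using t by (simp add: z_def)
  have "z \<in> neighborhood \<delta> B \<or> z \<in> neighborhood \<delta> C"
    using zA thin by (auto simp: neighborhood_def)
  then have "infdist z B \<le> \<delta>" "infdist z C \<le> \<delta>"
    using eq by (auto dest: infdist_le_of_neighborhood)
  then have "dist p z \<le> gromov_product p x y + 2 * \<delta>"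
    using dist_detour_le_infdist[OF B, of z] dist_detour_le_infdist[OF C, of z]
      dist_along_segment[OF A zA]
    by (simp add: gromov_product_def dist_commute field_simps)
  with zA that show thesis by blast
qed

text \<open>Up to \<open>2\<delta>\<close> the Gromov product \<open>(x|z)\<^sub>p\<close> is the distance from \<open>p\<close> to a geodesic \<open>[x,z]\<close>, and
  every point of this geodesic is \<open>\<delta>\<close>-close to \<open>[x,y]\<close> or to \<open>[y,z]\<close>.\<close>

lemma gromov_hyperbolic_imp_four_point:
  assumes "geodesic_space TYPE('a::metric_space)" "gromov_hyperbolic TYPE('a)"
  obtains \<delta> where "four_point TYPE('a) \<delta>"
proof -
  obtain \<delta> where \<delta>: "\<delta> \<ge> 0" and all: "\<forall>(x::'a) y z A B C.
      geodesic_segment x y A \<and> geodesic_segment y z B \<and> geodesic_segment z x C \<longrightarrow>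
      A \<subseteq> neighborhood \<delta> (B \<union> C) \<and> B \<subseteq> neighborhood \<delta> (C \<union> A) \<and> C \<subseteq> neighborhood \<delta> (A \<union> B)"
    using assms(2) unfolding gromov_hyperbolic_def by (elim exE conjE)
  have thin: "A \<subseteq> neighborhood \<delta> (B \<union> C)"
    if "geodesic_segment x y A" "geodesic_segment y z B" "geodesic_segment z x C"
    for x y z :: 'a and A B C
    using all[rule_format, of x y A z B C] that by simp
  have seg: "\<exists>S. geodesic_segment x y S" for x y :: 'a
    using assms(1) by (auto simp: geodesic_space_def)
  have "min (gromov_product p x y) (gromov_product p y z) - 3 * \<delta> \<le> gromov_product p x z"
    for p x y z :: 'a
  proof -
    obtain A B C where A: "geodesic_segment x z A" and B: "geodesic_segment z p B"
      and C: "geodesic_segment p x C"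
      using seg by meson
    obtain w where w: "w \<in> A" "dist p w \<le> gromov_product p x z + 2 * \<delta>"
      using thin_triangle_center[OF A B C thin[OF A B C]] by blast
    obtain D E where D: "geodesic_segment z y D" and E: "geodesic_segment y x E"
      using seg by meson
    obtain v where v: "v \<in> D \<union> E" "dist w v \<le> \<delta>"
      using w(1) thin[OF A D E] by (auto simp: neighborhood_def)
    have "min (gromov_product p x y) (gromov_product p y z) \<le> dist p v"
      using v(1) gromov_product_le_dist_segment[OF D, of v p]
        gromov_product_le_dist_segment[OF E, of v p]
      by (auto simp: gromov_product_commute[of p _ y])
    also have "dist p v \<le> dist p w + \<delta>"
      using dist_triangle[of p v w] v(2) by simp
    finally show ?thesis
      using w(2) by simp
  qed
  with \<delta> have "four_point TYPE('a) (3 * \<delta>)"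
    by (simp add: four_point_def)
  with that show thesis .
qed


section \<open>Geodesic rays\<close>

lemma geodesic_ray_dist:
  "geodesic_ray \<gamma> \<Longrightarrow> 0 \<le> s \<Longrightarrow> 0 \<le> t \<Longrightarrow> dist (\<gamma> s) (\<gamma> t) = \<bar>t - s\<bar>"
  by (simp add: geodesic_ray_def geodesic_on_def)

lemma geodesic_ray_dist_base:
  assumes "geodesic_ray \<gamma>" "0 \<le> t"
  shows "t - dist p (\<gamma> 0) \<le> dist p (\<gamma> t)" "dist p (\<gamma> t) \<le> t + dist p (\<gamma> 0)"
  using geodesic_ray_dist[OF assms(1), of 0 t] assms(2)
    dist_triangle[of p "\<gamma> t" "\<gamma> 0"] dist_triangle[of "\<gamma> 0" "\<gamma> t" p]
  by (auto simp: dist_commute)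

lemma asymptotic_boundE:
  assumes "asymptotic \<gamma> \<sigma>"
  obtains D where "\<And>t. t \<ge> 0 \<Longrightarrow> dist (\<gamma> t) (\<sigma> t) \<le> D"
  using assms by (auto simp: asymptotic_def bdd_above_def)

lemma asymptoticI:
  assumes "\<And>t. t \<ge> 0 \<Longrightarrow> dist (\<gamma> t) (\<sigma> t) \<le> D"
  shows "asymptotic \<gamma> \<sigma>"
  using assms by (auto simp: asymptotic_def bdd_above_def)

lemma endpoint_eq_iff:
  assumes "geodesic_ray \<gamma>" "geodesic_ray \<sigma>"
  shows "endpoint \<gamma> = endpoint \<sigma> \<longleftrightarrow> asymptotic \<gamma> \<sigma>"
  using eq_equiv_class_iff[OF equiv_asymptotic_rel, of \<gamma> \<sigma>] assms
  by (simp add: endpoint_def asymptotic_rel_def)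

lemma endpoint_in_boundary: "geodesic_ray \<gamma> \<Longrightarrow> endpoint \<gamma> \<in> gromov_boundary"
  by (auto simp: gromov_boundary_def endpoint_def intro: quotientI)

lemma boundary_repE:
  assumes "\<zeta> \<in> gromov_boundary"
  obtains \<gamma> where "geodesic_ray \<gamma>" "endpoint \<gamma> = \<zeta>"
  using assms by (auto simp: gromov_boundary_def endpoint_def elim!: quotientE)

lemma asymptotic_rays_gromov_product:
  assumes "geodesic_ray \<gamma>" "geodesic_ray \<sigma>" "asymptotic \<gamma> \<sigma>"
  shows "filterlim (\<lambda>t. gromov_product p (\<gamma> t) (\<sigma> t)) at_top at_top"
proof -
  obtain D where D: "\<And>t. t \<ge> 0 \<Longrightarrow> dist (\<gamma> t) (\<sigma> t) \<le> D"
    using asymptotic_boundE[OF assms(3)] by blast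
  define C where "C = (dist p (\<gamma> 0) + dist p (\<sigma> 0) + D) / 2"
  have "t - C \<le> gromov_product p (\<gamma> t) (\<sigma> t)" if "t \<ge> 0" for t
    using geodesic_ray_dist_base(1)[OF assms(1) that, of p]
      geodesic_ray_dist_base(1)[OF assms(2) that, of p] D[OF that]
    by (simp add: gromov_product_def C_def field_simps)
  then have "eventually (\<lambda>t. t - C \<le> gromov_product p (\<gamma> t) (\<sigma> t)) at_top"
    by (auto intro: eventually_at_top_linorderI)
  moreover have "filterlim (\<lambda>t::real. t - C) at_top at_top"
    using filterlim_tendsto_add_at_top[OF tendsto_const[of "-C"] filterlim_ident] by simp
  ultimately show ?thesis
    by (rule filterlim_at_top_mono[rotated])
qed

lemma gromov_product_along_ray:
  assumes "geodesic_ray \<gamma>" "0 \<le> s" "s \<le> t"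
  shows "s - dist p (\<gamma> 0) \<le> gromov_product p (\<gamma> s) (\<gamma> t)"
  using geodesic_ray_dist_base(1)[OF assms(1), of s p] geodesic_ray_dist_base(1)[OF assms(1), of t p]
    geodesic_ray_dist[OF assms(1), of s t] assms(2,3)
  by (simp add: gromov_product_def)

text \<open>If \<open>(\<gamma>(s)|\<sigma>(t))\<^sub>p\<close> is large, the two rays travel together for a time about as long: compare
  \<open>\<gamma>(u)\<close> with \<open>\<gamma>(s)\<close>, \<open>\<gamma>(s)\<close> with \<open>\<sigma>(t)\<close> and \<open>\<sigma>(t)\<close> with \<open>\<sigma>(u)\<close>.\<close>

lemma not_asymptotic_gromov_product_bounded:
  fixes \<gamma> \<sigma> :: "real \<Rightarrow> 'a::metric_space"
  assumes hyp: "four_point TYPE('a) \<delta>"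
    and \<gamma>: "geodesic_ray \<gamma>" and \<sigma>: "geodesic_ray \<sigma>" and not: "\<not> asymptotic \<gamma> \<sigma>"
  obtains M where "\<And>s t. s \<ge> 0 \<Longrightarrow> t \<ge> 0 \<Longrightarrow> gromov_product p (\<gamma> s) (\<sigma> t) \<le> M"
proof (rule ccontr)
  assume "\<not> thesis"
  then have unbdd: "\<exists>s\<ge>0. \<exists>t\<ge>0. gromov_product p (\<gamma> s) (\<sigma> t) > M" for M
    using that by (meson not_le)
  define C where "C = dist p (\<gamma> 0) + dist p (\<sigma> 0)"
  have "dist (\<gamma> u) (\<sigma> u) \<le> 3 * C + 4 * \<delta>" if u: "u \<ge> 0" for u
  proof -
    obtain s t where st: "s \<ge> 0" "t \<ge> 0" "gromov_product p (\<gamma> s) (\<sigma> t) > u + C"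
      using unbdd by blast
    have "u \<le> s" "u \<le> t"
      using st gromov_product_le_dist[of p "\<gamma> s" "\<sigma> t"]
        geodesic_ray_dist_base(2)[OF \<gamma> st(1), of p] geodesic_ray_dist_base(2)[OF \<sigma> st(2), of p]
        zero_le_dist[of p "\<gamma> 0"] zero_le_dist[of p "\<sigma> 0"]
      unfolding C_def by linarith+
    then have 1: "u - C \<le> gromov_product p (\<gamma> u) (\<gamma> s)"
      and 3: "u - C \<le> gromov_product p (\<sigma> t) (\<sigma> u)"
      using gromov_product_along_ray[OF \<gamma> u, of s p] gromov_product_along_ray[OF \<sigma> u, of t p]
        zero_le_dist[of p "\<gamma> 0"] zero_le_dist[of p "\<sigma> 0"]
      unfolding C_def gromov_product_commute[of p "\<sigma> t"] by linarith+
    have 2: "u - C \<le> gromov_product p (\<gamma> s) (\<sigma> t)"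
      using st zero_le_dist[of p "\<gamma> 0"] zero_le_dist[of p "\<sigma> 0"] unfolding C_def by linarith
    have "u - C - \<delta> \<le> gromov_product p (\<gamma> u) (\<sigma> t)"
      using four_pointD[OF hyp 1 2] .
    moreover have "u - C - \<delta> \<le> gromov_product p (\<sigma> t) (\<sigma> u)"
      using 3 hyp by (simp add: four_point_def)
    ultimately have "u - C - \<delta> - \<delta> \<le> gromov_product p (\<gamma> u) (\<sigma> u)"
      using four_pointD[OF hyp] by blast
    then show ?thesis
      using geodesic_ray_dist_base(2)[OF \<gamma> u, of p] geodesic_ray_dist_base(2)[OF \<sigma> u, of p]
      by (simp add: gromov_product_def C_def)
  qed
  then have "asymptotic \<gamma> \<sigma>"
    by (rule asymptoticI)
  with not show False ..
qed

text \<open>Seen from a far point \<open>\<gamma>(S)\<close>, which is close to \<open>\<sigma>(S)\<close>, neighbours in the chain \<open>\<gamma>(t)\<close>, \<open>\<gamma>(0)\<close>,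
  \<open>\<sigma>(0)\<close>, \<open>\<sigma>(t)\<close> have Gromov products at least \<open>S - t - 1\<close> once \<open>t\<close> exceeds the distance of the
  origins. The four-point condition gives almost the same bound for \<open>\<gamma>(t)\<close> and \<open>\<sigma>(t)\<close>.\<close>

lemma strongly_asymptotic_fellow_travel:
  fixes \<gamma> \<sigma> :: "real \<Rightarrow> 'a::metric_space"
  assumes hyp: "four_point TYPE('a) \<delta>"
    and \<gamma>: "geodesic_ray \<gamma>" and \<sigma>: "geodesic_ray \<sigma>"
    and lim: "((\<lambda>t. dist (\<gamma> t) (\<sigma> t)) \<longlongrightarrow> 0) at_top"
    and t: "dist (\<gamma> 0) (\<sigma> 0) \<le> t"
  shows "dist (\<gamma> t) (\<sigma> t) \<le> 3 + 4 * \<delta>"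
proof -
  have t0: "t \<ge> 0"
    using t zero_le_dist order_trans by blast
  have "eventually (\<lambda>s. dist (\<gamma> s) (\<sigma> s) < 1) at_top"
    using order_tendstoD(2)[OF lim] by simp
  then obtain S where S: "S \<ge> t" "dist (\<gamma> S) (\<sigma> S) < 1"
    using eventually_happens[OF eventually_conj[OF _ eventually_ge_at_top[of t]]] by force
  let ?p = "\<gamma> S"
  have \<sigma>dist: "S - u - 1 \<le> dist ?p (\<sigma> u)" "dist ?p (\<sigma> u) \<le> S - u + 1" if "0 \<le> u" "u \<le> S" for u
    using S t0 that geodesic_ray_dist[OF \<sigma>, of u S] dist_triangle[of ?p "\<sigma> u" "\<sigma> S"]
      dist_triangle[of "\<sigma> u" "\<sigma> S" ?p] by (auto simp: dist_commute)
  have \<gamma>dist: "dist ?p (\<gamma> u) = S - u" if "0 \<le> u" "u \<le> S" for u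
    using that geodesic_ray_dist[OF \<gamma>, of S u] by simp
  have 1: "S - t - 1 \<le> gromov_product ?p (\<gamma> t) (\<gamma> 0)"
    using \<gamma>dist[of t] \<gamma>dist[of 0] S t0 geodesic_ray_dist[OF \<gamma>, of t 0]
    by (simp add: gromov_product_def)
  have 2: "S - t - 1 \<le> gromov_product ?p (\<gamma> 0) (\<sigma> 0)"
    using \<gamma>dist[of 0] \<sigma>dist[of 0] S t0 t by (simp add: gromov_product_def)
  have 3: "S - t - 1 \<le> gromov_product ?p (\<sigma> 0) (\<sigma> t)"
    using \<sigma>dist[of 0] \<sigma>dist[of t] S t0 geodesic_ray_dist[OF \<sigma>, of 0 t]
    by (simp add: gromov_product_def)
  have "S - t - 1 - \<delta> \<le> gromov_product ?p (\<gamma> t) (\<sigma> 0)"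
    using four_pointD[OF hyp 1 2] .
  moreover have "S - t - 1 - \<delta> \<le> gromov_product ?p (\<sigma> 0) (\<sigma> t)"
    using 3 hyp by (simp add: four_point_def)
  ultimately have "S - t - 1 - \<delta> - \<delta> \<le> gromov_product ?p (\<gamma> t) (\<sigma> t)"
    using four_pointD[OF hyp] by blast
  then show ?thesis
    using \<gamma>dist[of t] \<sigma>dist[of t] S t0 by (simp add: gromov_product_def)
qed


section \<open>Convergence to a boundary point\<close>

text \<open>Convergence to the endpoint of a ray \<open>\<gamma>\<close> is used through one consequence only: the sequence
  leaves every closed set \<open>B \<subseteq> X\<close> on which the Gromov products with \<open>\<gamma>\<close> are bounded.\<close>

definition away_from :: "'a::metric_space \<Rightarrow> 'a set \<Rightarrow> (real \<Rightarrow> 'a) \<Rightarrow> bool" where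
  "away_from p B \<gamma> \<longleftrightarrow> (\<exists>M. \<forall>b\<in>B. \<forall>t\<ge>0. gromov_product p b (\<gamma> t) \<le> M)"

lemma eventually_Liminf_ereal:
  assumes "ereal r \<le> Liminf F (\<lambda>x. ereal (u x))" "q < r"
  shows "eventually (\<lambda>x. q < u x) F"
proof -
  have "eventually (\<lambda>x. ereal q < ereal (u x)) F"
    using assms le_Liminf_iff[of "ereal r" F "\<lambda>x. ereal (u x)"] by (metis less_ereal.simps(1))
  then show ?thesis by simp
qed

text \<open>If \<open>B\<close> is away from the boundary point \<open>\<eta>\<close>, then it is away from every point and every boundary
  point near \<open>\<eta>\<close>, because the four-point condition would transfer large products with such a point
  to \<open>\<eta>\<close>.\<close>

lemma gromov_open_complement:
  fixes p :: "'a::metric_space"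
  assumes hyp: "four_point TYPE('a) \<delta>" and B: "closed B"
  shows "gromov_open (Inl ` (- B) \<union> Inr ` {\<eta> \<in> gromov_boundary.
           \<exists>\<gamma>. geodesic_ray \<gamma> \<and> endpoint \<gamma> = \<eta> \<and> away_from p B \<gamma>})" (is "gromov_open ?U")
  unfolding gromov_open_def
proof (intro conjI allI impI)
  show "?U \<subseteq> UNIV <+> gromov_boundary"
    by auto
  have "Inl -` ?U = - B"
    by auto
  with B show "open (Inl -` ?U)"
    by (metis open_Compl)
  fix \<eta> q assume "Inr \<eta> \<in> ?U"
  then obtain \<gamma> M where \<gamma>: "geodesic_ray \<gamma>" "endpoint \<gamma> = \<eta>"
    and M: "\<And>b t. b \<in> B \<Longrightarrow> t \<ge> 0 \<Longrightarrow> gromov_product p b (\<gamma> t) \<le> M"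
    by (auto simp: away_from_def)
  have near: "eventually (\<lambda>t. K \<le> gromov_product p (\<gamma>' t) (\<gamma> t)) at_top"
    if "geodesic_ray \<gamma>'" "endpoint \<gamma>' = \<eta>" for \<gamma>' K
    using asymptotic_rays_gromov_product[OF that(1) \<gamma>(1)] endpoint_eq_iff[OF that(1) \<gamma>(1)] that(2) \<gamma>(2)
    by (simp add: filterlim_at_top)
  \<comment> \<open>Two applications of the four-point condition to products of size \<open>K\<close> still give more than \<open>M\<close>.\<close>
  define K where "K = M + 2 * \<delta> + 1"
  have \<delta>: "\<delta> \<ge> 0"
    using hyp by (simp add: four_point_def)
  \<comment> \<open>The distance accounts for the change of base point, the \<open>1\<close> for passing from lower limits to
    values.\<close>
  define r where "r = K + dist p q + 1"
  have r: "gromov_product p x y \<ge> K" if "gromov_product q x y > r - 1" for x y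
    using that gromov_product_change_base[of q x y p] by (simp add: r_def dist_commute)
  have "boundary_nhd q r \<eta> \<subseteq> ?U"
  proof
    fix u assume "u \<in> boundary_nhd q r \<eta>"
    then consider
        (point) y \<gamma>' where "u = Inl y" "geodesic_ray \<gamma>'" "endpoint \<gamma>' = \<eta>"
          "ereal r \<le> Liminf at_top (\<lambda>t. ereal (gromov_product q y (\<gamma>' t)))"
      | (boundary) \<gamma>' \<sigma> where "u = Inr (endpoint \<sigma>)" "geodesic_ray \<gamma>'" "endpoint \<gamma>' = \<eta>" "geodesic_ray \<sigma>"
          "ereal r \<le> Liminf (at_top \<times>\<^sub>F at_top) (\<lambda>(s, t). ereal (gromov_product q (\<gamma>' s) (\<sigma> t)))"
      unfolding boundary_nhd_def by blast
    then show "u \<in> ?U"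
    proof cases
      case point
      have "y \<notin> B"
      proof
        assume yB: "y \<in> B"
        have "eventually (\<lambda>t. r - 1 < gromov_product q y (\<gamma>' t)) at_top"
          using eventually_Liminf_ereal[OF point(4)] by simp
        then obtain t where t: "r - 1 < gromov_product q y (\<gamma>' t)"
            "K \<le> gromov_product p (\<gamma>' t) (\<gamma> t)" "t \<ge> 0"
          using eventually_happens[OF eventually_conj[OF _
              eventually_conj[OF near[OF point(2,3)] eventually_ge_at_top[of 0]]]] by force
        have "K - \<delta> \<le> gromov_product p y (\<gamma> t)"
          using four_pointD[OF hyp r[OF t(1)] t(2)] .
        then show False
          using M[OF yB t(3)] \<delta> by (simp add: K_def)
      qed
      then show ?thesis
        using point(1) by auto
    next
      case boundary
      have "eventually (\<lambda>(s, t). r - 1 < gromov_product q (\<gamma>' s) (\<sigma> t)) (at_top \<times>\<^sub>F at_top)"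
        using eventually_Liminf_ereal[of r _ "\<lambda>(s, t). gromov_product q (\<gamma>' s) (\<sigma> t)" "r - 1"] boundary(5)
        by (simp add: case_prod_unfold)
      then obtain Q where Q: "eventually Q at_top"
        "\<And>s t. Q s \<Longrightarrow> Q t \<Longrightarrow> r - 1 < gromov_product q (\<gamma>' s) (\<sigma> t)"
        unfolding eventually_prod_same by auto
      obtain t0 where t0: "\<And>t. t \<ge> t0 \<Longrightarrow> Q t"
        using Q(1) unfolding eventually_at_top_linorder by blast
      have late: "gromov_product p b (\<sigma> t) \<le> K" if "b \<in> B" "t \<ge> t0" for b t
      proof (rule ccontr)
        assume "\<not> ?thesis"
        then have 1: "K \<le> gromov_product p b (\<sigma> t)" by simp
        obtain s where s: "Q s" "K \<le> gromov_product p (\<gamma>' s) (\<gamma> s)" "s \<ge> 0"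
          using eventually_happens[OF eventually_conj[OF Q(1)
              eventually_conj[OF near[OF boundary(2,3)] eventually_ge_at_top[of 0]]]] by force
        have 2: "K \<le> gromov_product p (\<sigma> t) (\<gamma>' s)"
          using r[OF Q(2)[OF s(1) t0[OF that(2)]]] by (simp add: gromov_product_commute)
        have "K - \<delta> \<le> gromov_product p b (\<gamma>' s)"
          using four_pointD[OF hyp 1 2] .
        moreover have "K - \<delta> \<le> gromov_product p (\<gamma>' s) (\<gamma> s)"
          using s(2) \<delta> by simp
        ultimately have "K - \<delta> - \<delta> \<le> gromov_product p b (\<gamma> s)"
          using four_pointD[OF hyp] by blast
        then show False
          using M[OF that(1) s(3)] by (simp add: K_def)
      qed
      have "gromov_product p b (\<sigma> t) \<le> max K (t0 + dist p (\<sigma> 0))" if "b \<in> B" "t \<ge> 0" for b t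
        using late[OF that(1), of t] geodesic_ray_dist_base(2)[OF boundary(4) that(2), of p]
          gromov_product_le_dist(2)[of p b "\<sigma> t"]
        by (cases "t \<ge> t0") (auto simp: le_max_iff_disj)
      then have "away_from p B \<sigma>"
        unfolding away_from_def by blast
      then show ?thesis
        using boundary(1,4) endpoint_in_boundary by blast
    qed
  qed
  then show "\<exists>r. boundary_nhd q r \<eta> \<subseteq> ?U" ..
qed

lemma converging_sequence_leaves:
  fixes y :: "nat \<Rightarrow> 'a::metric_space"
  assumes "four_point TYPE('a) \<delta>" "closed B"
    and \<gamma>: "geodesic_ray \<gamma>" "away_from p B \<gamma>"
    and lim: "limitin gromov_compactification (\<lambda>n. Inl (y n)) (Inr (endpoint \<gamma>)) sequentially"
  shows "eventually (\<lambda>n. y n \<notin> B) sequentially"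
proof -
  have "eventually (\<lambda>n. Inl (y n) \<in> Inl ` (- B) \<union> Inr ` {\<eta> \<in> gromov_boundary.
           \<exists>\<gamma>. geodesic_ray \<gamma> \<and> endpoint \<gamma> = \<eta> \<and> away_from p B \<gamma>}) sequentially"
    using \<gamma> endpoint_in_boundary[OF \<gamma>(1)]
    by (intro limitinD[OF lim] gromov_open_complement[OF assms(1,2)]
        openin_gromov_compactification[THEN iffD2]) auto
  then show ?thesis
    by eventually_elim auto
qed

text \<open>A point \<open>a\<close> nearer to \<open>\<gamma>(0)\<close> than to \<open>\<gamma>(R)\<close> has \<open>(a|\<gamma>(R)) \<le> R/2\<close> seen from \<open>\<gamma>(0)\<close>, whereas
  \<open>(\<gamma>(t)|\<gamma>(R)) = R\<close> for \<open>t \<ge> R\<close>. Since \<open>R/2 < R - \<delta>\<close>, the product \<open>(a|\<gamma>(t))\<close> has to be below \<open>R\<close>.\<close>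

lemma half_space_away_from:
  fixes \<gamma> :: "real \<Rightarrow> 'a::metric_space"
  assumes hyp: "four_point TYPE('a) \<delta>" and \<gamma>: "geodesic_ray \<gamma>" and R: "R > 2 * \<delta>"
  shows "away_from (\<gamma> 0) {y. dist y (\<gamma> 0) \<le> dist y (\<gamma> R)} \<gamma>"
proof -
  have \<delta>: "\<delta> \<ge> 0"
    using hyp by (simp add: four_point_def)
  have "gromov_product (\<gamma> 0) a (\<gamma> t) \<le> R + \<delta>"
    if a: "dist a (\<gamma> 0) \<le> dist a (\<gamma> R)" and t: "t \<ge> 0" for a t
  proof (cases "t \<le> R + \<delta>")
    case True
    then show ?thesis
      using gromov_product_le_dist(2)[of "\<gamma> 0" a "\<gamma> t"] geodesic_ray_dist[OF \<gamma>, of 0 t] t by simp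
  next
    case False
    have 2: "gromov_product (\<gamma> 0) (\<gamma> t) (\<gamma> R) = R"
      using False t R \<delta> geodesic_ray_dist[OF \<gamma>, of 0 t] geodesic_ray_dist[OF \<gamma>, of 0 R]
        geodesic_ray_dist[OF \<gamma>, of t R]
      by (simp add: gromov_product_def)
    have 3: "gromov_product (\<gamma> 0) a (\<gamma> R) \<le> R / 2"
      using a R \<delta> geodesic_ray_dist[OF \<gamma>, of 0 R] by (simp add: gromov_product_def dist_commute)
    show ?thesis
    proof (rule ccontr)
      assume "\<not> ?thesis"
      then have "R \<le> gromov_product (\<gamma> 0) a (\<gamma> t)"
        using \<delta> by simp
      then have "R - \<delta> \<le> gromov_product (\<gamma> 0) a (\<gamma> R)"
        using four_pointD[OF hyp] 2 by (metis order_refl)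
      with 3 R show False
        by simp
    qed
  qed
  then show ?thesis
    unfolding away_from_def by blast
qed


section \<open>Isometries fix their attracting boundary points\<close>

lemma isometry_dist: "isometry f \<Longrightarrow> dist (f x) (f y) = dist x y"
  by (simp add: isometry_def)

lemma isometry_compose_ray: "isometry f \<Longrightarrow> geodesic_ray \<gamma> \<Longrightarrow> geodesic_ray (f \<circ> \<gamma>)"
  by (simp add: geodesic_ray_def geodesic_on_def isometry_dist)

text \<open>Suppose that \<open>f \<circ> \<gamma>\<close> and \<open>\<gamma>\<close> have different endpoints, so that their Gromov products are bounded.
  For large \<open>R\<close> the half-space of the points nearer to \<open>\<gamma>(0)\<close> than to \<open>\<gamma>(R)\<close> is away from \<open>\<gamma>\<close>. The
  points of the opposite half-space have products at least \<open>R/2\<close> with \<open>\<gamma>(R)\<close>, hence bounded ones with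
  \<open>f \<circ> \<gamma>\<close>, so its preimage under \<open>f\<close> is away from \<open>\<gamma>\<close>, too. An orbit converging to the endpoint of
  \<open>\<gamma>\<close> leaves the half-space and this preimage, although \<open>f\<^sup>n\<^sup>+\<^sup>1(x)\<close> lies in one of the two half-spaces.\<close>

lemma isometry_fixes_limit:
  fixes f :: "'a::metric_space \<Rightarrow> 'a"
  assumes hyp: "four_point TYPE('a) \<delta>" and f: "isometry f" and \<gamma>: "geodesic_ray \<gamma>"
    and lim: "limitin gromov_compactification (\<lambda>n. Inl ((f ^^ n) x)) (Inr (endpoint \<gamma>)) sequentially"
  shows "asymptotic (f \<circ> \<gamma>) \<gamma>"
proof (rule ccontr)
  assume "\<not> ?thesis"
  from not_asymptotic_gromov_product_bounded[OF hyp isometry_compose_ray[OF f \<gamma>] \<gamma> this, of "\<gamma> 0"]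
  obtain M where M: "\<And>s t. s \<ge> 0 \<Longrightarrow> t \<ge> 0 \<Longrightarrow> gromov_product (\<gamma> 0) (f (\<gamma> s)) (\<gamma> t) \<le> M"
    by auto
  have \<delta>: "\<delta> \<ge> 0"
    using hyp by (simp add: four_point_def)
  define R where "R = 2 * (\<bar>M\<bar> + \<delta> + 1)"
  have R: "R > 2 * \<delta>" "R / 2 > M + \<delta>"
    using \<delta> by (auto simp: R_def)
  let ?A = "{y. dist y (\<gamma> 0) \<le> dist y (\<gamma> R)}"
  let ?B = "{y. dist (f y) (\<gamma> R) \<le> dist (f y) (\<gamma> 0)}"
  have "continuous_on UNIV f"
    unfolding continuous_on_iff using isometry_dist[OF f] by auto
  then have closed: "closed ?A" "closed ?B"
    by (intro closed_Collect_le continuous_intros)+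
  have "gromov_product (\<gamma> 0) b (\<gamma> t) \<le> R / 2 + dist (\<gamma> 0) (f (\<gamma> 0))"
    if b: "b \<in> ?B" and t: "t \<ge> 0" for b t
  proof (rule ccontr)
    assume "\<not> ?thesis"
    then have "R / 2 + dist (\<gamma> 0) (f (\<gamma> 0)) < gromov_product (f (\<gamma> 0)) (f b) (f (\<gamma> t))"
      by (simp add: gromov_product_def isometry_dist[OF f])
    then have 1: "R / 2 \<le> gromov_product (\<gamma> 0) (f (\<gamma> t)) (f b)"
      using gromov_product_change_base[of "f (\<gamma> 0)" "f b" "f (\<gamma> t)" "\<gamma> 0"]
      by (simp add: dist_commute gromov_product_commute[of _ "f b"])
    have 2: "R / 2 \<le> gromov_product (\<gamma> 0) (f b) (\<gamma> R)"
      using b R \<delta> geodesic_ray_dist[OF \<gamma>, of 0 R] by (simp add: gromov_product_def dist_commute)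
    show False
      using four_pointD[OF hyp 1 2] M[OF t, of R] R \<delta> by simp
  qed
  then have "away_from (\<gamma> 0) ?B \<gamma>"
    unfolding away_from_def by blast
  then have "eventually (\<lambda>n. (f ^^ n) x \<notin> ?B) sequentially"
    using converging_sequence_leaves[OF hyp closed(2) \<gamma> _ lim] by blast
  moreover have "eventually (\<lambda>n. (f ^^ n) x \<notin> ?A) sequentially"
    using converging_sequence_leaves[OF hyp closed(1) \<gamma> half_space_away_from[OF hyp \<gamma> R(1)] lim] .
  then have "eventually (\<lambda>n. (f ^^ Suc n) x \<notin> ?A) sequentially"
    by (rule eventually_sequentially_Suc[THEN iffD2])
  ultimately have "eventually (\<lambda>n::nat. False) sequentially"
    by eventually_elim auto
  then show False
    by simp
qed


section \<open>Translation along a ray\<close>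

lemma funpow_isometry_dist:
  assumes "isometry f"
  shows "dist ((f ^^ n) x) ((f ^^ n) y) = dist x y"
  by (induction n) (simp_all add: isometry_dist[OF assms])

lemma isometry_inv_left: "isometry f \<Longrightarrow> inv f (f x) = x"
  by (simp add: isometry_def bij_is_inj)

lemma isometry_inv_right: "isometry f \<Longrightarrow> f (inv f x) = x"
  by (simp add: isometry_def bij_is_surj surj_f_inv_f)

lemma isometry_inv:
  assumes "isometry f"
  shows "isometry (inv f)"
proof -
  have "dist (inv f x) (inv f y) = dist x y" for x y
    using isometry_dist[OF assms, of "inv f x" "inv f y"] by (simp add: isometry_inv_right[OF assms])
  then show ?thesis
    using assms by (simp add: isometry_def bij_imp_bij_inv)
qed

lemma funpow_inv_cancel:
  assumes "isometry f"
  shows "(f ^^ n) ((inv f ^^ n) x) = x"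
proof (induction n arbitrary: x)
  case (Suc n)
  have "(f ^^ Suc n) ((inv f ^^ Suc n) x) = (f ^^ n) (f (inv f ((inv f ^^ n) x)))"
    by (simp add: funpow_swap1)
  then show ?case
    by (simp add: isometry_inv_right[OF assms] Suc)
qed simp

text \<open>This gives \<open>f\<close> and its inverse the same divergence rate.\<close>

lemma dist_funpow_inv:
  assumes "isometry f"
  shows "dist x ((inv f ^^ n) x) = dist x ((f ^^ n) x)"
  using funpow_isometry_dist[OF assms, of n x "(inv f ^^ n) x"]
  by (simp add: funpow_inv_cancel[OF assms] dist_commute)

definition translates_asymptotically :: "('a::metric_space \<Rightarrow> 'a) \<Rightarrow> (real \<Rightarrow> 'a) \<Rightarrow> real \<Rightarrow> bool" where
  "translates_asymptotically f \<gamma> T \<longleftrightarrow> ((\<lambda>t. dist (f (\<gamma> t)) (\<gamma> (t + T))) \<longlongrightarrow> 0) at_top"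

lemma filterlim_shift_at_top: "filterlim (\<lambda>t::real. t + c) at_top at_top"
  using filterlim_tendsto_add_at_top[OF tendsto_const[of c] filterlim_ident] by (simp add: add.commute)

lemma translates_asymptotically_inv:
  assumes f: "isometry f" and "translates_asymptotically f \<gamma> T"
  shows "translates_asymptotically (inv f) \<gamma> (- T)"
proof -
  have "((\<lambda>t. dist (f (\<gamma> (t + - T))) (\<gamma> (t + - T + T))) \<longlongrightarrow> 0) at_top"
    using filterlim_compose[OF assms(2)[unfolded translates_asymptotically_def]
        filterlim_shift_at_top[of "- T"]] .
  moreover have "dist (f (\<gamma> (t + - T))) (\<gamma> (t + - T + T)) = dist (inv f (\<gamma> t)) (\<gamma> (t + - T))" for t
    using isometry_dist[OF f, of "\<gamma> (t - T)" "inv f (\<gamma> t)"]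
    by (simp add: isometry_inv_right[OF f] dist_commute)
  ultimately show ?thesis
    by (simp add: translates_asymptotically_def)
qed

lemma translates_asymptotically_funpow:
  assumes f: "isometry f" and T: "translates_asymptotically f \<gamma> T"
  shows "translates_asymptotically (f ^^ n) \<gamma> (real n * T)"
proof (induction n)
  case 0
  then show ?case by (simp add: translates_asymptotically_def)
next
  case (Suc n)
  let ?u = "\<lambda>t. dist ((f ^^ n) (\<gamma> t)) (\<gamma> (t + real n * T))"
  let ?v = "\<lambda>t. dist (f (\<gamma> (t + real n * T))) (\<gamma> (t + real n * T + T))"
  have "(?u \<longlongrightarrow> 0) at_top"
    using Suc by (simp only: translates_asymptotically_def)
  moreover have "(?v \<longlongrightarrow> 0) at_top"
    using filterlim_compose[OF T[unfolded translates_asymptotically_def]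
        filterlim_shift_at_top[of "real n * T"]] .
  ultimately have lim: "((\<lambda>t. ?u t + ?v t) \<longlongrightarrow> 0) at_top"
    by (rule tendsto_add_zero)
  have le: "dist ((f ^^ Suc n) (\<gamma> t)) (\<gamma> (t + real (Suc n) * T)) \<le> ?u t + ?v t" for t
  proof -
    have shift: "t + real (Suc n) * T = t + real n * T + T"
      by (simp add: distrib_right)
    have "dist (f ((f ^^ n) (\<gamma> t))) (f (\<gamma> (t + real n * T))) = ?u t"
      by (rule isometry_dist[OF f])
    then show ?thesis
      unfolding shift funpow.simps o_apply
      using dist_triangle[of "f ((f ^^ n) (\<gamma> t))" "\<gamma> (t + real n * T + T)" "f (\<gamma> (t + real n * T))"]
      by linarith
  qed
  show ?case
    unfolding translates_asymptotically_def
    by (rule Lim_null_comparison[OF _ lim], rule always_eventually, rule allI)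
      (simp only: real_norm_def abs_of_nonneg zero_le_dist le)
qed

text \<open>Far out on the ray each iteration costs an error of at most \<open>\<epsilon>\<close>.\<close>

lemma translates_asymptotically_error:
  assumes f: "isometry f" and T: "translates_asymptotically f \<gamma> T" "T \<ge> 0" and "\<epsilon> > 0"
  obtains s where "s \<ge> 0" "\<And>n. dist ((f ^^ n) (\<gamma> s)) (\<gamma> (s + real n * T)) \<le> real n * \<epsilon>"
proof -
  have "eventually (\<lambda>t. dist (f (\<gamma> t)) (\<gamma> (t + T)) < \<epsilon>) at_top"
    using order_tendstoD(2)[OF T(1)[unfolded translates_asymptotically_def] \<open>\<epsilon> > 0\<close>] .
  then obtain s0 where s0: "\<And>t. t \<ge> s0 \<Longrightarrow> dist (f (\<gamma> t)) (\<gamma> (t + T)) < \<epsilon>"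
    unfolding eventually_at_top_linorder by blast
  define s where "s = max s0 0"
  have "dist ((f ^^ n) (\<gamma> s)) (\<gamma> (s + real n * T)) \<le> real n * \<epsilon>" for n
  proof (induction n)
    case (Suc n)
    have "dist (f (\<gamma> (s + real n * T))) (\<gamma> (s + real n * T + T)) < \<epsilon>"
      using mult_nonneg_nonneg[OF of_nat_0_le_iff[of n] T(2)] max.cobounded1[of s0 0]
      unfolding s_def by (intro s0) linarith
    moreover have "dist ((f ^^ Suc n) (\<gamma> s)) (f (\<gamma> (s + real n * T))) \<le> real n * \<epsilon>"
      using Suc.IH by (simp add: isometry_dist[OF f])
    moreover have shift: "s + real (Suc n) * T = s + real n * T + T"
        "real (Suc n) * \<epsilon> = real n * \<epsilon> + \<epsilon>"
      by (simp_all add: distrib_right)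
    ultimately show ?case
      unfolding shift
      using dist_triangle[of "(f ^^ Suc n) (\<gamma> s)" "\<gamma> (s + real n * T + T)" "f (\<gamma> (s + real n * T))"]
      by linarith
  qed simp
  then show thesis
    by (rule that[rotated]) (simp add: s_def)
qed

lemma abs_displacement_diff_le:
  assumes "\<And>x y. dist (f x) (f y) = dist x y"
  shows "\<bar>dist x (f x) - dist y (f y)\<bar> \<le> 2 * dist x y"
  using dist_triangle[of x "f x" y] dist_triangle[of y "f x" "f y"] dist_triangle[of y "f y" x]
    dist_triangle[of x "f y" "f x"] assms[of x y] assms[of y x] dist_commute[of x y]
  by linarith

text \<open>The orbit of \<open>\<gamma>(s)\<close> follows the points \<open>\<gamma>(s + n T)\<close> up to \<open>n \<epsilon>\<close>, and orbits of different points
  stay at a constant distance.\<close>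

lemma translates_asymptotically_rate:
  assumes f: "isometry f" and \<gamma>: "geodesic_ray \<gamma>"
    and T: "translates_asymptotically f \<gamma> T" "T \<ge> 0"
  shows "(\<lambda>n. dist x ((f ^^ n) x) / real n) \<longlonglongrightarrow> T"
proof (rule LIMSEQ_I)
  fix e :: real assume e: "e > 0"
  obtain s where s: "s \<ge> 0"
    and err: "\<And>n. dist ((f ^^ n) (\<gamma> s)) (\<gamma> (s + real n * T)) \<le> real n * (e / 2)"
    using translates_asymptotically_error[OF f T half_gt_zero[OF e]] by blast
  define D where "D = dist x (\<gamma> s)"
  obtain N where N: "N > 0" "real N * e > 4 * D"
  proof -
    obtain N :: nat where "real N > 4 * D / e"
      using reals_Archimedean2 by blast
    then have "real (Suc N) * e > 4 * D"
      using e by (simp add: field_simps)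
    then show thesis
      by (rule that[OF zero_less_Suc])
  qed
  have "norm (dist x ((f ^^ n) x) / real n - T) < e" if n: "n \<ge> N" for n
  proof -
    have n0: "real n > 0"
      using n N by simp
    have "dist (\<gamma> s) (\<gamma> (s + real n * T)) = real n * T"
      using geodesic_ray_dist[OF \<gamma>, of s "s + real n * T"] s T(2) by simp
    then have "\<bar>dist (\<gamma> s) ((f ^^ n) (\<gamma> s)) - real n * T\<bar> \<le> real n * (e / 2)"
      using err[of n] abs_dist_diff_le[of "(f ^^ n) (\<gamma> s)" "\<gamma> s" "\<gamma> (s + real n * T)"]
        dist_commute[of "\<gamma> s" "(f ^^ n) (\<gamma> s)"]
      by linarith
    moreover have "\<bar>dist x ((f ^^ n) x) - dist (\<gamma> s) ((f ^^ n) (\<gamma> s))\<bar> \<le> 2 * D"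
      using abs_displacement_diff_le[of "f ^^ n" x "\<gamma> s"] funpow_isometry_dist[OF f]
      by (simp add: D_def)
    moreover have "4 * D < real n * e"
      using N(2) mult_right_mono[of "real N" "real n" e] n e by linarith
    ultimately have "\<bar>dist x ((f ^^ n) x) - real n * T\<bar> < real n * e"
      by linarith
    then have "\<bar>dist x ((f ^^ n) x) - real n * T\<bar> / real n < e"
      using n0 by (simp only: pos_divide_less_eq mult.commute)
    moreover have "dist x ((f ^^ n) x) / real n - T = (dist x ((f ^^ n) x) - real n * T) / real n"
      using n0 by (simp add: diff_divide_distrib)
    ultimately show ?thesis
      by simp
  qed
  then show "\<exists>N. \<forall>n\<ge>N. norm (dist x ((f ^^ n) x) / real n - T) < e"
    by (intro exI[of _ N]) simp
qed

lemma divergence_rate_eqI: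
  assumes "\<And>x. (\<lambda>n. dist x ((f ^^ n) x) / real n) \<longlonglongrightarrow> c"
  shows "divergence_rate f = c"
  unfolding divergence_rate_def
proof (rule the_equality)
  show "\<forall>x. (\<lambda>n. dist x ((f ^^ n) x) / real n) \<longlonglongrightarrow> c"
    using assms ..
  show "d = c" if "\<forall>x. (\<lambda>n. dist x ((f ^^ n) x) / real n) \<longlonglongrightarrow> d" for d
    using LIMSEQ_unique[OF that[rule_format] assms] .
qed

text \<open>The shift is negative if \<open>f\<close> moves the ray towards its origin. In that case the inverse moves it
  outwards, at the same rate.\<close>

lemma hyperbolic_translates:
  assumes hyp: "hyperbolic f" and \<gamma>: "geodesic_ray \<gamma>" and T: "translates_asymptotically f \<gamma> T"
  obtains g where "g = f \<or> g = inv f" "translates_asymptotically g \<gamma> (divergence_rate f)"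
proof -
  have f: "isometry f"
    using hyp by (simp add: hyperbolic_def)
  show thesis
  proof (cases "T \<ge> 0")
    case True
    have "divergence_rate f = T"
      by (rule divergence_rate_eqI) (rule translates_asymptotically_rate[OF f \<gamma> T True])
    then show thesis
      using that T by blast
  next
    case False
    have T': "translates_asymptotically (inv f) \<gamma> (- T)"
      using translates_asymptotically_inv[OF f T] .
    have "divergence_rate f = - T"
      using translates_asymptotically_rate[OF isometry_inv[OF f] \<gamma> T'] False
      by (intro divergence_rate_eqI) (simp add: dist_funpow_inv[OF f])
    then show thesis
      using that[of "inv f"] T' by simp
  qed
qed

text \<open>Suppose that \<open>f\<^sup>m(\<gamma>(0))\<close> is within \<open>N T\<close> of \<open>\<gamma>(m T)\<close>. After the time \<open>N T\<close> the rays
  \<open>f\<^sup>m \<circ> \<gamma>\<close> and \<open>\<gamma>(\<cdot> + m T)\<close> are uniformly close, so the distance for \<open>m + N\<close> is at most the one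
  for \<open>N\<close> plus a constant. As the distance for \<open>N\<close> grows sublinearly in \<open>N\<close>, some \<open>N\<close> reproduces the bound.\<close>

lemma orbit_close_to_ray:
  fixes \<gamma> :: "real \<Rightarrow> 'a::metric_space"
  assumes hyp: "four_point TYPE('a) \<delta>" and f: "isometry f" and \<gamma>: "geodesic_ray \<gamma>"
    and T: "translates_asymptotically f \<gamma> T" "T > 0"
  obtains N where "N > 0"
    "\<And>k. dist ((f ^^ (k * N)) (\<gamma> 0)) (\<gamma> (real (k * N) * T)) \<le> real N * T"
proof -
  define K where "K = 3 + 4 * \<delta>"
  obtain s where s: "s \<ge> 0"
    and err: "\<And>n. dist ((f ^^ n) (\<gamma> s)) (\<gamma> (s + real n * T)) \<le> real n * (T / 2)"
    using translates_asymptotically_error[OF f T(1) less_imp_le[OF T(2)] half_gt_zero[OF T(2)]] by blast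
  \<comment> \<open>The slope \<open>T/2\<close> is smaller than \<open>T\<close>, which is all that the choice of \<open>N\<close> requires.\<close>
  have sublinear: "dist ((f ^^ n) (\<gamma> 0)) (\<gamma> (real n * T)) \<le> 2 * s + real n * (T / 2)" for n
    using err[of n] funpow_isometry_dist[OF f, of n "\<gamma> 0" "\<gamma> s"] s T(2)
      geodesic_ray_dist[OF \<gamma>, of 0 s] geodesic_ray_dist[OF \<gamma>, of "s + real n * T" "real n * T"]
      dist_triangle[of "(f ^^ n) (\<gamma> 0)" "\<gamma> (real n * T)" "(f ^^ n) (\<gamma> s)"]
      dist_triangle[of "(f ^^ n) (\<gamma> s)" "\<gamma> (real n * T)" "\<gamma> (s + real n * T)"]
    by simp
  obtain n :: nat where "real n > (2 * s + K) / (T / 2)"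
    using reals_Archimedean2 by blast
  then have n: "real (Suc n) * (T / 2) \<ge> 2 * s + K"
    using T(2) by (simp add: field_simps)
  define N where "N = Suc n"
  have N: "dist ((f ^^ N) (\<gamma> 0)) (\<gamma> (real N * T)) + K \<le> real N * T"
    using sublinear[of N] n by (simp add: N_def field_simps)
  have "dist ((f ^^ (k * N)) (\<gamma> 0)) (\<gamma> (real (k * N) * T)) \<le> real N * T" for k
  proof (induction k)
    case 0
    then show ?case using T(2) by simp
  next
    case (Suc k)
    define m where "m = k * N"
    let ?\<sigma> = "\<lambda>t. \<gamma> (t + real m * T)"
    have "geodesic_ray ((f ^^ m) \<circ> \<gamma>)" "geodesic_ray ?\<sigma>"
      using \<gamma> T(2) by (auto simp: geodesic_ray_def geodesic_on_def funpow_isometry_dist[OF f])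
    moreover have "((\<lambda>t. dist (((f ^^ m) \<circ> \<gamma>) t) (?\<sigma> t)) \<longlongrightarrow> 0) at_top"
      using translates_asymptotically_funpow[OF f T(1), of m]
      by (simp add: translates_asymptotically_def)
    ultimately have "dist (((f ^^ m) \<circ> \<gamma>) (real N * T)) (?\<sigma> (real N * T)) \<le> K"
      unfolding K_def using Suc
      by (intro strongly_asymptotic_fellow_travel[OF hyp, of "(f ^^ m) \<circ> \<gamma>" ?\<sigma>]) (simp_all add: m_def)
    moreover have "dist ((f ^^ (m + N)) (\<gamma> 0)) ((f ^^ m) (\<gamma> (real N * T)))
        = dist ((f ^^ N) (\<gamma> 0)) (\<gamma> (real N * T))"
      by (simp add: funpow_add funpow_isometry_dist[OF f])
    ultimately have "dist ((f ^^ (m + N)) (\<gamma> 0)) (?\<sigma> (real N * T)) \<le> real N * T"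
      using N dist_triangle[of "(f ^^ (m + N)) (\<gamma> 0)" "?\<sigma> (real N * T)" "(f ^^ m) (\<gamma> (real N * T))"]
      by simp
    then show ?case
      by (simp add: m_def algebra_simps)
  qed
  then show thesis
    using that[of N] by (simp add: N_def)
qed


section \<open>Existence of an axis\<close>

text \<open>A pointwise cluster point, from Tychonoff's theorem. Conditions on two values at a time suffice
  below, for instance for the distance of \<open>\<sigma>(s)\<close> and \<open>\<sigma>(t)\<close>.\<close>

lemma pointwise_cluster_point:
  fixes X :: "nat \<Rightarrow> real \<Rightarrow> 'a::metric_space"
  assumes "proper_space TYPE('a)" and bound: "\<And>k t. dist p (X k t) \<le> r t"
  obtains \<sigma> where
    "\<forall>s t. \<forall>\<epsilon>>0. \<forall>m. \<exists>k\<ge>m. dist (X k s) (\<sigma> s) < \<epsilon> \<and> dist (X k t) (\<sigma> t) < \<epsilon>"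
proof -
  define S where "S = PiE UNIV (\<lambda>t. cball p (r t))"
  have "compactin (product_topology (\<lambda>_. euclidean) UNIV) S"
    unfolding S_def compactin_PiE using assms(1) by (auto simp: proper_space_def)
  then have S: "compact S"
    by (simp add: euclidean_product_topology)
  have nonempty: "filtermap X sequentially \<noteq> bot"
    by (simp add: filtermap_bot_iff)
  have "X k \<in> S" for k
    using bound by (auto simp: S_def)
  then have inS: "eventually (\<lambda>x. x \<in> S) (filtermap X sequentially)"
    by (simp add: eventually_filtermap)
  obtain \<sigma> where \<sigma>: "inf (nhds \<sigma>) (filtermap X sequentially) \<noteq> bot"
    using S[unfolded compact_filter, rule_format, OF nonempty inS] ..
  have "\<exists>k\<ge>m. dist (X k s) (\<sigma> s) < \<epsilon> \<and> dist (X k t) (\<sigma> t) < \<epsilon>" if \<epsilon>: "\<epsilon> > 0" for s t \<epsilon> m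
  proof (rule ccontr)
    assume none: "\<not> ?thesis"
    define V where "V = {x. dist (x s) (\<sigma> s) < \<epsilon> \<and> dist (x t) (\<sigma> t) < \<epsilon>}"
    have "open V"
      unfolding V_def
      by (intro open_Collect_conj open_Collect_less continuous_on_dist
          continuous_on_product_coordinates continuous_on_const)
    then have "eventually (\<lambda>x. x \<in> V) (nhds \<sigma>)"
      using \<epsilon> by (intro eventually_nhds_in_open) (auto simp: V_def)
    moreover have "eventually (\<lambda>x. x \<notin> V) (filtermap X sequentially)"
      unfolding eventually_filtermap eventually_sequentially using none by (auto simp: V_def)
    ultimately have "eventually (\<lambda>x. False) (inf (nhds \<sigma>) (filtermap X sequentially))"
      unfolding eventually_inf
      by (intro exI[of _ "\<lambda>x. x \<in> V"] exI[of _ "\<lambda>x. x \<notin> V"]) simp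
    with \<sigma> show False
      by (simp add: trivial_limit_def)
  qed
  then show thesis
    by (intro that allI impI)
qed

text \<open>The curves \<open>f\<^sup>-\<^sup>m(\<gamma>(\<cdot> + m T))\<close> are geodesics on \<open>[-m T, \<infinity>)\<close>, and \<open>f\<close> shifts them by \<open>T\<close> up to an
  error that tends to \<open>0\<close> with \<open>m\<close>. For the multiples \<open>m\<close> of a suitable \<open>N\<close> they stay
  bounded, and any cluster point is an axis.\<close>

lemma invariant_line_exists:
  fixes \<gamma> :: "real \<Rightarrow> 'a::metric_space"
  assumes proper: "proper_space TYPE('a)" and hyp: "four_point TYPE('a) \<delta>"
    and f: "isometry f" and \<gamma>: "geodesic_ray \<gamma>"
    and T: "translates_asymptotically f \<gamma> T" "T > 0"
  obtains \<sigma> where "geodesic_line \<sigma>" "\<And>t. f (\<sigma> t) = \<sigma> (t + T)" "asymptotic \<sigma> \<gamma>"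
proof -
  obtain N where N: "N > 0"
    and close: "\<And>k. dist ((f ^^ (k * N)) (\<gamma> 0)) (\<gamma> (real (k * N) * T)) \<le> real N * T"
    using orbit_close_to_ray[OF hyp f \<gamma> T] by blast
  define h where "h = real N * T"
  define g where "g m = inv f ^^ m" for m
  have fg: "(f ^^ m) (g m x) = x" for m x
    by (simp add: g_def funpow_inv_cancel[OF f])
  have dist_g: "dist (g m x) (g m y) = dist x y" for m x y
    by (simp add: g_def funpow_isometry_dist[OF isometry_inv[OF f]])
  have dist_g_left: "dist (g m x) y = dist x ((f ^^ m) y)" for m x y
    using funpow_isometry_dist[OF f, of m "g m x" y] by (simp add: fg)
  define m where "m k = k * N" for k
  have m: "real (m k) * T \<ge> real k * h" for k
    by (simp add: m_def h_def)
  have late: "\<exists>k. \<forall>k'\<ge>k. t \<le> real (m k') * T" for t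
  proof -
    obtain k :: nat where k: "real k > t / h"
      using reals_Archimedean2 by blast
    have h: "h > 0"
      using N T(2) by (simp add: h_def)
    have "t \<le> real (m k') * T" if "k' \<ge> k" for k'
    proof -
      have "t \<le> real k * h"
        using k h by (simp add: field_simps)
      also have "\<dots> \<le> real k' * h"
        using that h by (simp add: mult_right_mono)
      finally show ?thesis
        using m[of k'] by simp
    qed
    then show ?thesis by blast
  qed
  define \<tau> where "\<tau> k t = g (m k) (\<gamma> (t + real (m k) * T))" for k t
  \<comment> \<open>Before its start the geodesic is continued by a constant, which keeps its values bounded.\<close>
  define X where "X k t = (if - t \<le> real (m k) * T then \<tau> k t else \<gamma> 0)" for k t
  have \<tau>0: "dist (\<gamma> 0) (\<tau> k 0) \<le> h" for k
    using close[of k] dist_g_left[of "m k" "\<gamma> (real (m k) * T)" "\<gamma> 0"]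
    by (simp add: \<tau>_def m_def h_def dist_commute)
  have \<tau>_geodesic: "dist (\<tau> k s) (\<tau> k t) = \<bar>t - s\<bar>"
    if "- s \<le> real (m k) * T" "- t \<le> real (m k) * T" for k s t
    using that geodesic_ray_dist[OF \<gamma>, of "s + real (m k) * T" "t + real (m k) * T"]
    by (simp add: \<tau>_def dist_g)
  have bound: "dist (\<gamma> 0) (X k t) \<le> h + \<bar>t\<bar>" for k t
  proof (cases "- t \<le> real (m k) * T")
    case True
    then show ?thesis
      using \<tau>0[of k] \<tau>_geodesic[of 0 k t] dist_triangle[of "\<gamma> 0" "\<tau> k t" "\<tau> k 0"] T(2)
      by (simp add: X_def)
  next
    case False
    then show ?thesis
      using T(2) by (simp add: X_def h_def)
  qed
  obtain \<sigma> where \<sigma>: "\<forall>s t. \<forall>\<epsilon>>0. \<forall>k0.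
      \<exists>k\<ge>k0. dist (X k s) (\<sigma> s) < \<epsilon> \<and> dist (X k t) (\<sigma> t) < \<epsilon>"
    using pointwise_cluster_point[OF proper bound] .
  have cluster: "\<exists>k\<ge>k0. dist (\<tau> k s) (\<sigma> s) < \<epsilon> \<and> dist (\<tau> k t) (\<sigma> t) < \<epsilon>
      \<and> - s \<le> real (m k) * T \<and> - t \<le> real (m k) * T" if \<epsilon>: "\<epsilon> > 0" for s t \<epsilon> k0
  proof -
    obtain k1 k2 where k12: "\<And>k. k \<ge> k1 \<Longrightarrow> - s \<le> real (m k) * T" "\<And>k. k \<ge> k2 \<Longrightarrow> - t \<le> real (m k) * T"
      using late[of "- s"] late[of "- t"] by blast
    obtain k where "k \<ge> max k0 (max k1 k2)" "dist (X k s) (\<sigma> s) < \<epsilon>" "dist (X k t) (\<sigma> t) < \<epsilon>"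
      using \<sigma>[rule_format, OF \<epsilon>, of "max k0 (max k1 k2)" s t] by blast
    with k12[of k] show ?thesis
      by (intro exI[of _ k]) (simp add: X_def)
  qed
  have "geodesic_line \<sigma>"
    unfolding geodesic_line_def geodesic_on_def
  proof (intro ballI)
    fix s t :: real
    have "\<bar>dist (\<sigma> s) (\<sigma> t) - \<bar>t - s\<bar>\<bar> \<le> 0 + \<epsilon>" if \<epsilon>: "\<epsilon> > 0" for \<epsilon>
    proof -
      obtain k where k: "dist (\<tau> k s) (\<sigma> s) < \<epsilon> / 2" "dist (\<tau> k t) (\<sigma> t) < \<epsilon> / 2"
        "- s \<le> real (m k) * T" "- t \<le> real (m k) * T"
        using cluster[OF half_gt_zero[OF \<epsilon>], of 0 s t] by blast
      have "dist (\<sigma> s) (\<sigma> t) \<le> dist (\<sigma> s) (\<tau> k s) + dist (\<tau> k s) (\<tau> k t) + dist (\<tau> k t) (\<sigma> t)"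
        "dist (\<tau> k s) (\<tau> k t) \<le> dist (\<tau> k s) (\<sigma> s) + dist (\<sigma> s) (\<sigma> t) + dist (\<sigma> t) (\<tau> k t)"
        using dist_triangle[of "\<sigma> s" "\<sigma> t" "\<tau> k s"] dist_triangle[of "\<tau> k s" "\<sigma> t" "\<tau> k t"]
          dist_triangle[of "\<tau> k s" "\<tau> k t" "\<sigma> s"] dist_triangle[of "\<sigma> s" "\<tau> k t" "\<sigma> t"] by linarith+
      then show ?thesis
        using k(1,2) \<tau>_geodesic[OF k(3,4)] unfolding dist_commute[of "\<sigma> s" "\<tau> k s"]
          dist_commute[of "\<sigma> t" "\<tau> k t"] by linarith
    qed
    then have "\<bar>dist (\<sigma> s) (\<sigma> t) - \<bar>t - s\<bar>\<bar> \<le> 0"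
      by (rule field_le_epsilon)
    then show "dist (\<sigma> s) (\<sigma> t) = \<bar>t - s\<bar>"
      by simp
  qed
  moreover have "f (\<sigma> t) = \<sigma> (t + T)" for t
  proof -
    have "dist (f (\<sigma> t)) (\<sigma> (t + T)) \<le> 0 + \<epsilon>" if \<epsilon>: "\<epsilon> > 0" for \<epsilon>
    proof -
      have \<epsilon>3: "\<epsilon> / 3 > 0"
        using \<epsilon> by simp
      have "eventually (\<lambda>u. dist (f (\<gamma> u)) (\<gamma> (u + T)) < \<epsilon> / 3) at_top"
        using order_tendstoD(2)[OF T(1)[unfolded translates_asymptotically_def] \<epsilon>3] .
      then obtain u0 where u0: "\<And>u. u \<ge> u0 \<Longrightarrow> dist (f (\<gamma> u)) (\<gamma> (u + T)) < \<epsilon> / 3"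
        unfolding eventually_at_top_linorder by blast
      obtain k0 where k0: "\<And>k. k \<ge> k0 \<Longrightarrow> u0 - t \<le> real (m k) * T"
        using late by blast
      obtain k where k: "k \<ge> k0" "dist (\<tau> k t) (\<sigma> t) < \<epsilon> / 3" "dist (\<tau> k (t + T)) (\<sigma> (t + T)) < \<epsilon> / 3"
        using cluster[OF \<epsilon>3, of k0 t "t + T"] by blast
      let ?u = "t + real (m k) * T"
      have "f (\<tau> k t) = g (m k) (f (\<gamma> ?u))"
      proof -
        have commute: "f (inv f y) = inv f (f y)" for y
          by (simp add: isometry_inv_left[OF f] isometry_inv_right[OF f])
        have "f (g j x) = g j (f x)" for j x
          unfolding g_def by (induction j) (simp_all add: commute)
        then show ?thesis
          by (simp add: \<tau>_def)
      qed
      then have "dist (f (\<tau> k t)) (\<tau> k (t + T)) = dist (f (\<gamma> ?u)) (\<gamma> (?u + T))"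
        by (simp add: \<tau>_def dist_g algebra_simps)
      also have "\<dots> < \<epsilon> / 3"
        using k0[OF k(1)] by (intro u0) simp
      finally show ?thesis
        using k(2,3) isometry_dist[OF f, of "\<tau> k t" "\<sigma> t"]
          dist_triangle[of "f (\<sigma> t)" "\<sigma> (t + T)" "f (\<tau> k t)"]
          dist_triangle[of "f (\<tau> k t)" "\<sigma> (t + T)" "\<tau> k (t + T)"]
          dist_commute[of "f (\<sigma> t)" "f (\<tau> k t)"] by linarith
    qed
    then have "dist (f (\<sigma> t)) (\<sigma> (t + T)) \<le> 0"
      by (rule field_le_epsilon)
    then show ?thesis
      by simp
  qed
  moreover have "asymptotic \<sigma> \<gamma>"
  proof (rule asymptoticI)
    fix t :: real assume t: "t \<ge> 0"
    obtain k where k: "dist (\<tau> k t) (\<sigma> t) < 1"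
      using cluster[OF zero_less_one, of 0 t t] by blast
    define \<mu> where "\<mu> = (\<lambda>t. \<gamma> (t + real (m k) * T))"
    have rays: "geodesic_ray ((f ^^ m k) \<circ> \<gamma>)" "geodesic_ray \<mu>"
      using \<gamma> T(2) by (auto simp: \<mu>_def geodesic_ray_def geodesic_on_def funpow_isometry_dist[OF f])
    have "((\<lambda>t. dist (((f ^^ m k) \<circ> \<gamma>) t) (\<mu> t)) \<longlongrightarrow> 0) at_top"
      using translates_asymptotically_funpow[OF f T(1), of "m k"]
      by (simp add: translates_asymptotically_def \<mu>_def)
    note fellow = strongly_asymptotic_fellow_travel[OF hyp rays this]
    have start: "dist (((f ^^ m k) \<circ> \<gamma>) 0) (\<mu> 0) \<le> h"
      using close[of k] by (simp add: \<mu>_def m_def h_def)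
    have "dist (((f ^^ m k) \<circ> \<gamma>) t) (\<mu> t) \<le> 3 * h + (3 + 4 * \<delta>)"
    proof (cases "h \<le> t")
      case True
      then show ?thesis
        using fellow[of t] start T(2) by (simp add: h_def add_increasing)
    next
      case False
      have "\<delta> \<ge> 0"
        using hyp by (simp add: four_point_def)
      then show ?thesis
        using False start t geodesic_ray_dist[OF rays(1), of t 0] geodesic_ray_dist[OF rays(2), of 0 t]
          dist_triangle[of "((f ^^ m k) \<circ> \<gamma>) t" "\<mu> t" "((f ^^ m k) \<circ> \<gamma>) 0"]
          dist_triangle[of "((f ^^ m k) \<circ> \<gamma>) 0" "\<mu> t" "\<mu> 0"] by linarith
    qed
    moreover have "dist (\<tau> k t) (\<gamma> t) = dist (((f ^^ m k) \<circ> \<gamma>) t) (\<mu> t)"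
      by (simp add: \<tau>_def \<mu>_def dist_g_left) (rule dist_commute)
    ultimately show "dist (\<sigma> t) (\<gamma> t) \<le> 3 * h + (3 + 4 * \<delta>) + 1"
      using k dist_triangle[of "\<sigma> t" "\<gamma> t" "\<tau> k t"] by (simp add: dist_commute)
  qed
  ultimately show thesis
    by (rule that)
qed


section \<open>Geodesic lines with the same image\<close>

lemma geodesic_line_dist: "geodesic_line \<gamma> \<Longrightarrow> dist (\<gamma> s) (\<gamma> t) = \<bar>t - s\<bar>"
  by (simp add: geodesic_line_def geodesic_on_def)

lemma geodesic_line_imp_ray: "geodesic_line \<gamma> \<Longrightarrow> geodesic_ray \<gamma>"
  by (simp add: geodesic_line_def geodesic_ray_def geodesic_on_def)

lemma real_isometry_affine:
  fixes \<phi> :: "real \<Rightarrow> real"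
  assumes \<phi>: "\<And>s t. \<bar>\<phi> s - \<phi> t\<bar> = \<bar>s - t\<bar>"
  obtains e b where "e = 1 \<or> e = - 1" "\<And>t. \<phi> t = e * t + b"
proof -
  define e where "e = \<phi> 1 - \<phi> 0"
  have e: "e = 1 \<or> e = - 1"
    using \<phi>[of 1 0] by (auto simp: e_def)
  have "\<phi> t = e * t + \<phi> 0" for t
    using e
  proof
    assume "e = 1"
    then have "\<phi> 1 = \<phi> 0 + 1"
      by (simp add: e_def)
    then show ?thesis
      using \<phi>[of t 0] \<phi>[of t 1] \<open>e = 1\<close> by (auto simp: abs_if split: if_splits)
  next
    assume "e = - 1"
    then have "\<phi> 1 = \<phi> 0 - 1"
      by (simp add: e_def)
    then show ?thesis
      using \<phi>[of t 0] \<phi>[of t 1] \<open>e = - 1\<close> by (auto simp: abs_if split: if_splits)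
  qed
  with e that show thesis by blast
qed

lemma same_range_lines:
  assumes \<gamma>: "geodesic_line \<gamma>" and \<sigma>: "geodesic_line \<sigma>" and "range \<sigma> \<subseteq> range \<gamma>"
  obtains e b where "e = 1 \<or> e = - 1" "\<And>t. \<sigma> t = \<gamma> (e * t + b)"
proof -
  have "\<exists>u. \<sigma> t = \<gamma> u" for t
    using assms(3) by auto
  then obtain \<phi> where \<phi>: "\<And>t. \<sigma> t = \<gamma> (\<phi> t)"
    by metis
  have "\<bar>\<phi> s - \<phi> t\<bar> = \<bar>s - t\<bar>" for s t
    using geodesic_line_dist[OF \<sigma>, of s t] geodesic_line_dist[OF \<gamma>, of "\<phi> s" "\<phi> t"] \<phi>
    by (simp add: abs_minus_commute)
  then show thesis
    using real_isometry_affine[of \<phi>] that \<phi> by metis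
qed

lemma reparametrization_if_same_range:
  assumes "geodesic_line \<gamma>" "geodesic_line \<sigma>" "range \<sigma> \<subseteq> range \<gamma>"
  shows "reparametrization \<gamma> \<sigma>"
proof -
  obtain e b where e: "e = 1 \<or> e = - 1" and \<sigma>: "\<And>t. \<sigma> t = \<gamma> (e * t + b)"
    using same_range_lines[OF assms] by blast
  have "bij (\<lambda>t. e * t + b)"
    using e by (intro bij_betw_byWitness[of _ "\<lambda>t. e * (t - b)"]) auto
  moreover have "dist (e * s + b) (e * t + b) = dist s t" for s t :: real
    using e by (auto simp: dist_real_def)
  ultimately show ?thesis
    unfolding reparametrization_def isometry_def
    by (intro exI[of _ "\<lambda>t. e * t + b"]) (auto simp: \<sigma>)
qed


section \<open>Uniqueness of the axis\<close>

lemma hyperbolic_no_fixed_point: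
  assumes "hyperbolic f"
  shows "f x \<noteq> x"
proof
  assume fx: "f x = x"
  have "(f ^^ n) x = x" for n
    by (induction n) (simp_all add: fx)
  then have "bounded (range (\<lambda>n. (f ^^ n) x))"
    by simp
  then show False
    using assms by (auto simp: hyperbolic_def elliptic_def)
qed

text \<open>An isometry that reverses an invariant line fixes a point of it, so here the line is translated.
  The amount is the divergence rate \<open>c\<close>, in the direction of increasing parameter if the line is
  suitably oriented.\<close>

lemma invariant_line_translation:
  assumes f: "isometry f" and nofix: "\<And>x. f x \<noteq> x"
    and rate: "\<And>x. (\<lambda>n. dist x ((f ^^ n) x) / real n) \<longlonglongrightarrow> c"
    and \<sigma>: "is_axis f \<sigma>"
  obtains \<rho> where "geodesic_line \<rho>" "range \<rho> = range \<sigma>" "\<And>t. f (\<rho> t) = \<rho> (t + c)"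
proof -
  have line: "geodesic_line \<sigma>" and inv: "f ` range \<sigma> = range \<sigma>"
    using \<sigma> by (auto simp: is_axis_def)
  have "geodesic_line (f \<circ> \<sigma>)"
    using line by (simp add: geodesic_line_def geodesic_on_def isometry_dist[OF f])
  moreover have "range (f \<circ> \<sigma>) \<subseteq> range \<sigma>"
    using inv by (simp add: image_comp)
  ultimately obtain e b where e: "e = 1 \<or> e = - 1" and shift: "\<And>t. (f \<circ> \<sigma>) t = \<sigma> (e * t + b)"
    using same_range_lines[OF line] by blast
  have "e = 1"
  proof (rule ccontr)
    assume "e \<noteq> 1"
    then have "f (\<sigma> (b / 2)) = \<sigma> (b / 2)"
      using e shift[of "b / 2"] by simp
    with nofix show False by blast
  qed
  then have f\<sigma>: "f (\<sigma> t) = \<sigma> (t + b)" for t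
    using shift[of t] by simp
  have "(f ^^ n) (\<sigma> 0) = \<sigma> (real n * b)" for n
    by (induction n) (simp_all add: f\<sigma> algebra_simps)
  then have "dist (\<sigma> 0) ((f ^^ n) (\<sigma> 0)) / real n = \<bar>b\<bar>" if "n > 0" for n
    using that by (simp add: geodesic_line_dist[OF line] abs_mult)
  then have "(\<lambda>n. dist (\<sigma> 0) ((f ^^ n) (\<sigma> 0)) / real n) \<longlonglongrightarrow> \<bar>b\<bar>"
    by (intro tendsto_eventually eventually_sequentiallyI[of 1]) simp
  then have b: "\<bar>b\<bar> = c"
    using LIMSEQ_unique rate by blast
  show thesis
  proof (cases "b = c")
    case True
    then show thesis
      using that[of \<sigma>] line f\<sigma> by simp
  next
    case False
    then have b: "b = - c"
      using b by linarith
    have "range (\<lambda>t. \<sigma> (- t)) = range \<sigma>"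
      using bij_is_surj[OF bij_uminus[where 'a = real]] by (metis image_image)
    moreover have "geodesic_line (\<lambda>t. \<sigma> (- t))"
      by (simp add: geodesic_line_def geodesic_on_def geodesic_line_dist[OF line] abs_minus_commute)
    moreover have "f (\<sigma> (- t)) = \<sigma> (- (t + c))" for t
      by (simp add: f\<sigma> b)
    ultimately show thesis
      by (intro that[of "\<lambda>t. \<sigma> (- t)"])
  qed
qed

text \<open>The distance between two lines translated by the same amount is periodic. Hence their rays
  are asymptotic, and when these are strongly asymptotic the lines coincide.\<close>

lemma translated_lines_same_range:
  assumes f: "isometry f" and c: "c > 0"
    and \<sigma>: "geodesic_line \<sigma>" "\<And>t. f (\<sigma> t) = \<sigma> (t + c)"
    and \<rho>: "geodesic_line \<rho>" "\<And>t. f (\<rho> t) = \<rho> (t + c)"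
    and approaching: "approaching_geodesics_at (endpoint \<sigma>)"
  shows "range \<rho> = range \<sigma>"
proof -
  have periodic: "dist (\<sigma> (s + real n * c)) (\<rho> (t + real n * c)) = dist (\<sigma> s) (\<rho> t)" for s t n
  proof (induction n)
    case (Suc n)
    have "dist (\<sigma> (s + real (Suc n) * c)) (\<rho> (t + real (Suc n) * c))
        = dist (f (\<sigma> (s + real n * c))) (f (\<rho> (t + real n * c)))"
      by (simp add: \<sigma>(2) \<rho>(2) algebra_simps)
    then show ?case
      using Suc by (simp add: isometry_dist[OF f])
  qed simp
  have "asymptotic \<rho> \<sigma>"
  proof (rule asymptoticI)
    fix t :: real assume t: "t \<ge> 0"
    define n where "n = nat \<lfloor>t / c\<rfloor>"
    have n: "real n * c \<le> t" "t \<le> real n * c + c"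
    proof -
      have "real n = of_int \<lfloor>t / c\<rfloor>"
        using t c by (simp add: n_def)
      then have "real n \<le> t / c" "t / c \<le> real n + 1"
        by linarith+
      then show "real n * c \<le> t" "t \<le> real n * c + c"
        using c by (simp_all add: field_simps)
    qed
    then have "dist (\<rho> t) (\<rho> (real n * c)) \<le> c" "dist (\<sigma> (real n * c)) (\<sigma> t) \<le> c"
      by (simp_all add: geodesic_line_dist \<sigma>(1) \<rho>(1))
    moreover have "dist (\<sigma> (real n * c)) (\<rho> (real n * c)) = dist (\<sigma> 0) (\<rho> 0)"
      using periodic[of 0 n 0] by simp
    ultimately show "dist (\<rho> t) (\<sigma> t) \<le> 2 * c + dist (\<sigma> 0) (\<rho> 0)"
      using dist_triangle[of "\<rho> t" "\<sigma> t" "\<rho> (real n * c)"]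
        dist_triangle[of "\<rho> (real n * c)" "\<sigma> t" "\<sigma> (real n * c)"]
      by (simp add: dist_commute)
  qed
  then have "endpoint \<rho> = endpoint \<sigma>"
    using endpoint_eq_iff geodesic_line_imp_ray \<sigma>(1) \<rho>(1) by blast
  then have "strongly_asymptotic \<sigma> \<rho>"
    using approaching geodesic_line_imp_ray \<sigma>(1) \<rho>(1)
    unfolding approaching_geodesics_at_def by blast
  then obtain a where a: "((\<lambda>t. dist (\<sigma> t) (\<rho> (t + a))) \<longlongrightarrow> 0) at_top"
    by (auto simp: strongly_asymptotic_def)
  have eq: "\<sigma> t = \<rho> (t + a)" for t
  proof -
    have "filterlim (\<lambda>n. t + real n * c) at_top sequentially"
      using c by (intro filterlim_tendsto_add_at_top[OF tendsto_const]
          filterlim_at_top_mult_tendsto_pos[OF tendsto_const] filterlim_real_sequentially)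
    from filterlim_compose[OF a this]
    have "(\<lambda>n. dist (\<sigma> (t + real n * c)) (\<rho> (t + a + real n * c))) \<longlonglongrightarrow> 0"
      by (simp add: algebra_simps)
    then have "(\<lambda>n::nat. dist (\<sigma> t) (\<rho> (t + a))) \<longlonglongrightarrow> 0"
      by (simp add: periodic)
    then show ?thesis
      by (simp add: LIMSEQ_const_iff)
  qed
  show ?thesis
  proof
    show "range \<sigma> \<subseteq> range \<rho>"
      using eq by auto
    have "\<rho> t = \<sigma> (t - a)" for t
      using eq[of "t - a"] by simp
    then show "range \<rho> \<subseteq> range \<sigma>"
      by auto
  qed
qed

lemma is_axis_inv:
  assumes "isometry f"
  shows "is_axis (inv f) \<gamma> \<longleftrightarrow> is_axis f \<gamma>"
proof -
  have "inv f ` f ` S = S" "f ` inv f ` S = S" for S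
    using assms by (simp_all add: isometry_def bij_is_inj bij_is_surj image_inv_f_f image_f_inv_f)
  then have "inv f ` S = S \<longleftrightarrow> f ` S = S" for S
    by metis
  then show ?thesis
    by (simp add: is_axis_def)
qed

section \<open>Hyperbolic isometries are axial\<close>

theorem proposition4p20:
  fixes f :: "'a::metric_space \<Rightarrow> 'a" and \<zeta> :: "(real \<Rightarrow> 'a) set"
  assumes "proper_space TYPE('a)"
    and "geodesic_space TYPE('a)"
    and "gromov_hyperbolic TYPE('a)"
    and "hyperbolic f"
    and "denjoy_wolff_point f \<zeta>"
    and "approaching_geodesics_at \<zeta>"
  shows "axial f \<and> (\<forall>\<gamma> \<sigma>. is_axis f \<gamma> \<and> is_axis f \<sigma> \<longrightarrow> reparametrization \<gamma> \<sigma>)"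
proof -
  obtain \<delta> where hyp: "four_point TYPE('a) \<delta>"
    using gromov_hyperbolic_imp_four_point assms(2,3) by blast
  have f: "isometry f" and c: "divergence_rate f > 0"
    using assms(4) by (auto simp: hyperbolic_def)
  have nofix: "f x \<noteq> x" for x
    using hyperbolic_no_fixed_point[OF assms(4)] .
  obtain \<gamma> where \<gamma>: "geodesic_ray \<gamma>" "endpoint \<gamma> = \<zeta>"
    using assms(5) boundary_repE unfolding denjoy_wolff_point_def by blast
  have "limitin gromov_compactification (\<lambda>n. Inl ((f ^^ n) (\<gamma> 0))) (Inr (endpoint \<gamma>)) sequentially"
    using assms(5) by (simp add: denjoy_wolff_point_def \<gamma>(2))
  then have "asymptotic (f \<circ> \<gamma>) \<gamma>"
    using isometry_fixes_limit[OF hyp f \<gamma>(1)] by blast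
  then have "endpoint (f \<circ> \<gamma>) = \<zeta>"
    using endpoint_eq_iff isometry_compose_ray[OF f \<gamma>(1)] \<gamma> by blast
  then have "strongly_asymptotic (f \<circ> \<gamma>) \<gamma>"
    using assms(6) isometry_compose_ray[OF f \<gamma>(1)] \<gamma> unfolding approaching_geodesics_at_def by blast
  then obtain T where "translates_asymptotically f \<gamma> T"
    by (auto simp: strongly_asymptotic_def translates_asymptotically_def)
  then obtain g where g: "g = f \<or> g = inv f"
    and tr: "translates_asymptotically g \<gamma> (divergence_rate f)"
    using hyperbolic_translates[OF assms(4) \<gamma>(1)] by blast
  have g_iso: "isometry g"
    using g f isometry_inv by blast
  have g_nofix: "g x \<noteq> x" for x
    using g nofix isometry_inv_right[OF f, of x] by metis
  have axis_g: "is_axis g \<sigma> \<longleftrightarrow> is_axis f \<sigma>" for \<sigma>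
    using g is_axis_inv[OF f] by blast
  obtain \<sigma>0 where \<sigma>0: "geodesic_line \<sigma>0" "\<And>t. g (\<sigma>0 t) = \<sigma>0 (t + divergence_rate f)"
      "asymptotic \<sigma>0 \<gamma>"
    using invariant_line_exists[OF assms(1) hyp g_iso \<gamma>(1) tr c] by blast
  have approaching: "approaching_geodesics_at (endpoint \<sigma>0)"
    using \<sigma>0(3) endpoint_eq_iff[OF geodesic_line_imp_ray[OF \<sigma>0(1)] \<gamma>(1)] \<gamma>(2) assms(6) by simp
  have "g ` range \<sigma>0 = range \<sigma>0"
  proof -
    have "\<sigma>0 t = g (\<sigma>0 (t - divergence_rate f))" for t
      by (simp add: \<sigma>0(2))
    then have "range \<sigma>0 \<subseteq> g ` range \<sigma>0"
      by (metis image_eqI image_subsetI rangeI)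
    moreover have "g ` range \<sigma>0 \<subseteq> range \<sigma>0"
      using \<sigma>0(2) by auto
    ultimately show ?thesis
      by simp
  qed
  then have "is_axis g \<sigma>0"
    using \<sigma>0(1) by (simp add: is_axis_def)
  then have "is_axis f \<sigma>0"
    using axis_g by blast
  with f nofix have "axial f"
    by (auto simp: axial_def)
  moreover have range: "range \<sigma> = range \<sigma>0" if \<sigma>: "is_axis f \<sigma>" for \<sigma>
  proof -
    have "is_axis g \<sigma>"
      using \<sigma> axis_g by blast
    show ?thesis
    proof (rule invariant_line_translation[OF g_iso g_nofix
          translates_asymptotically_rate[OF g_iso \<gamma>(1) tr less_imp_le[OF c]] \<open>is_axis g \<sigma>\<close>])
      fix \<rho> assume \<rho>: "geodesic_line \<rho>" "range \<rho> = range \<sigma>"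
        "\<And>t. g (\<rho> t) = \<rho> (t + divergence_rate f)"
      show ?thesis
        using translated_lines_same_range[OF g_iso c \<sigma>0(1,2) \<rho>(1,3) approaching] \<rho>(2) by simp
    qed
  qed
  have "reparametrization \<gamma> \<sigma>" if "is_axis f \<gamma>" "is_axis f \<sigma>" for \<gamma> \<sigma>
    using that range[OF that(1)] range[OF that(2)]
    by (intro reparametrization_if_same_range) (simp_all add: is_axis_def)
  ultimately show ?thesis
    by blast
qed

end
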